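(* Let $s, t \geq 2$ be integers. Every $n$-vertex $K^{\ast}_{s,t}$-minor-free graph $G$ is isomorphic to a subgraph of $H \boxtimes K_{\lfloor m \rfloor}$ for some graph $H$ with $\mathrm{tw}(H) \leq s$, where $m := 2\sqrt{(s-1)(t-1)n}$.
   Context: All graphs are finite, simple and undirected. $\mathrm{tw}$ denotes treewidth. $K^{\ast}_{s,t}$ is the graph whose vertex-set is partitioned into $A \cup B$ with $|A| = s$, $|B| = t$, $A$ a clique, $B$ an independent set, and every vertex of $A$ adjacent to every vertex of $B$ (i.e. $K_{s,t}$ with all edges added inside the part of size $s$). The strong product $A \boxtimes B$ of graphs has vertex-set $V(A)\times V(B)$, where distinct $(v,x),(w,y)$ are adjacent if ($v=w$ and $xy\in E(B)$), or ($x=y$ and $vw\in E(A)$), or ($vw\in E(A)$ and $xy\in E(B)$). $K_m$ is the complete graph on $m$ vertices. *)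

theory Defs
  imports Complex_Main "Graph_Theory.Graph_Theory"
begin

text \<open>
  A finite simple undirected graph is a symmetric loop-free finite digraph whose arcs are
  pairs of vertices, i.e. a \<^term>\<open>G :: 'a pair_pre_digraph\<close> with \<^prop>\<open>pair_graph G\<close>.
  Each undirected edge is represented by its two orientations.
\<close>

abbreviation connected_graph :: "'a pair_pre_digraph \<Rightarrow> bool" where
  "connected_graph G \<equiv> Digraph_Component.connected (with_proj G)"

abbreviation connected_in :: "'a pair_pre_digraph \<Rightarrow> 'a set \<Rightarrow> bool" where
  "connected_in G S \<equiv> Digraph_Component.connected (with_proj G \<restriction> S)"

text \<open>The library notion of connectedness requires at least one vertex.\<close>

lemma connected_graph_nonempty: "connected_graph G \<Longrightarrow> pverts G \<noteq> {}"
  by (simp add: Digraph_Component.connected_def strongly_connected_def mk_symmetric_def)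

lemma connected_in_nonempty: "connected_in G S \<Longrightarrow> S \<noteq> {}"
  by (simp add: Digraph_Component.connected_def strongly_connected_def mk_symmetric_def)


text \<open>
  The library predicate \<^const>\<open>Digraph_Component.tree\<close> cannot be used here: in a symmetric
  digraph it counts every edge, traversed back and forth, as a cycle of length 2.
\<close>

definition undirected_tree :: "'a pair_pre_digraph \<Rightarrow> bool" where
  "undirected_tree T \<longleftrightarrow> pair_graph T \<and> connected_graph T
     \<and> \<not> (\<exists>p. pre_digraph.cycle (with_proj T) p \<and> length p \<ge> 3)"

text \<open>
  Every vertex lies in some bag, because \<^const>\<open>connected_in\<close> excludes the empty set.
\<close>

definition tree_decomposition ::
    "'a pair_pre_digraph \<Rightarrow> 'b pair_pre_digraph \<Rightarrow> ('b \<Rightarrow> 'a set) \<Rightarrow> bool" where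
  "tree_decomposition G T bag \<longleftrightarrow>
     undirected_tree T
   \<and> (\<forall>x \<in> pverts T. bag x \<subseteq> pverts G)
   \<and> (\<forall>(v, w) \<in> parcs G. \<exists>x \<in> pverts T. v \<in> bag x \<and> w \<in> bag x)
   \<and> (\<forall>v \<in> pverts G. connected_in T {x \<in> pverts T. v \<in> bag x})"

definition decomposition_width :: "'b pair_pre_digraph \<Rightarrow> ('b \<Rightarrow> 'a set) \<Rightarrow> nat" where
  "decomposition_width T bag = Max ((\<lambda>x. card (bag x)) ` pverts T) - 1"

text \<open>
  Trees are finite, so taking their nodes to be natural numbers is no restriction.
  By truncated subtraction the graph without vertices gets treewidth 0.
\<close>

definition treewidth :: "'a pair_pre_digraph \<Rightarrow> nat" where
  "treewidth G = (LEAST k. \<exists>(T :: nat pair_pre_digraph) bag.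
     tree_decomposition G T bag \<and> decomposition_width T bag = k)"


text \<open>\<^term>\<open>branch x\<close> is the connected set of vertices contracted to the vertex \<^term>\<open>x\<close> of the minor.\<close>

definition is_minor :: "'b pair_pre_digraph \<Rightarrow> 'a pair_pre_digraph \<Rightarrow> bool" where
  "is_minor X G \<longleftrightarrow> (\<exists>branch :: 'b \<Rightarrow> 'a set.
     (\<forall>x \<in> pverts X. branch x \<subseteq> pverts G \<and> connected_in G (branch x))
   \<and> (\<forall>x \<in> pverts X. \<forall>y \<in> pverts X. x \<noteq> y \<longrightarrow> branch x \<inter> branch y = {})
   \<and> (\<forall>(x, y) \<in> parcs X. \<exists>u \<in> branch x. \<exists>v \<in> branch y. (u, v) \<in> parcs G))"

definition minor_free :: "'b pair_pre_digraph \<Rightarrow> 'a pair_pre_digraph \<Rightarrow> bool" where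
  "minor_free X G \<longleftrightarrow> \<not> is_minor X G"


definition Kstar :: "nat \<Rightarrow> nat \<Rightarrow> nat pair_pre_digraph" where
  "Kstar s t = (let A = {0..<s}; B = {s..<s + t} in
     \<lparr> pverts = A \<union> B,
       parcs = {(u, v). u \<in> A \<and> v \<in> A \<and> u \<noteq> v} \<union> A \<times> B \<union> B \<times> A \<rparr>)"

definition complete_graph :: "nat \<Rightarrow> nat pair_pre_digraph" where
  "complete_graph k =
     \<lparr> pverts = {0..<k}, parcs = {(u, v). u \<in> {0..<k} \<and> v \<in> {0..<k} \<and> u \<noteq> v} \<rparr>"

definition strong_product ::
    "'a pair_pre_digraph \<Rightarrow> 'b pair_pre_digraph \<Rightarrow> ('a \<times> 'b) pair_pre_digraph"
    (infixl \<open>\<boxtimes>\<close> 70) where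
  "A \<boxtimes> B =
     \<lparr> pverts = pverts A \<times> pverts B,
       parcs = {((v, x), (w, y)).
         (v, x) \<in> pverts A \<times> pverts B \<and> (w, y) \<in> pverts A \<times> pverts B
         \<and> (v = w \<and> (x, y) \<in> parcs B
           \<or> x = y \<and> (v, w) \<in> parcs A
           \<or> (v, w) \<in> parcs A \<and> (x, y) \<in> parcs B)} \<rparr>"

definition isomorphic_to_subgraph :: "'a pair_pre_digraph \<Rightarrow> 'b pair_pre_digraph \<Rightarrow> bool" where
  "isomorphic_to_subgraph G Q \<longleftrightarrow>
     (\<exists>S. subgraph S (with_proj Q) \<and> digraph_iso (with_proj G) S)"


lemma complete_graph_complete: "complete_digraph k (with_proj (complete_graph k))"
  by (simp add: complete_digraph_pair_def complete_graph_def)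

lemma pair_graph_Kstar: "pair_graph (Kstar s t)"
proof -
  have "finite (parcs (Kstar s t))"
    by (rule finite_subset[of _ "{0..<s + t} \<times> {0..<s + t}"]) (auto simp: Kstar_def Let_def)
  then show ?thesis
    by unfold_locales (auto simp: Kstar_def Let_def symmetric_def sym_def)
qed

lemma pair_graph_strong_product:
  assumes "pair_graph A" and "pair_graph B"
  shows "pair_graph (A \<boxtimes> B)"
proof -
  interpret A: pair_graph A by fact
  interpret B: pair_graph B by fact
  have fin: "finite (pverts (A \<boxtimes> B))"
    by (simp add: strong_product_def A.pair_finite_verts B.pair_finite_verts)
  have "parcs (A \<boxtimes> B) \<subseteq> pverts (A \<boxtimes> B) \<times> pverts (A \<boxtimes> B)"
    by (auto simp: strong_product_def)
  with fin have "finite (parcs (A \<boxtimes> B))"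
    by (meson finite_SigmaI finite_subset)
  with fin show ?thesis
    by unfold_locales
      (auto simp: strong_product_def symmetric_def sym_def
        dest: A.no_loops' B.no_loops' A.arcs_symmetric B.arcs_symmetric)
qed

end

theory Submission
  imports Defs
begin

text \<open>
  The vertices of \<open>G\<close> are cut into parts of size at most \<open>\<lfloor>m\<rfloor>\<close>, one part at a time. Every
  component \<open>C\<close> of what is left has its neighbours in at most \<open>s\<close> parts, which lie in disjoint
  connected, pairwise adjacent sets \<open>U\<^sub>b\<close> outside \<open>C\<close>. A connected subset of \<open>C\<close> adjacent to all
  the \<open>U\<^sub>b\<close> can serve as a new part while there are fewer than \<open>s\<close> of them. Otherwise the new
  part is an inclusion-minimal set \<open>Y \<subseteq> C\<close> such that no component of \<open>C - Y\<close> is adjacent to all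
  the \<open>U\<^sub>b\<close>. If a component \<open>D\<close> of \<open>C - Y\<close> is not adjacent to \<open>U\<^sub>b\<close>, then minimality of \<open>Y\<close>
  connects every vertex of \<open>Y\<close> to \<open>U\<^sub>b\<close> outside \<open>D\<close>, so that \<open>U\<^sub>b\<close> can be enlarged to contain
  \<open>Y\<close>; in the clique guarding \<open>D\<close>, the part \<open>Y\<close> replaces the part of \<open>U\<^sub>b\<close>.

  A small \<open>Y\<close> exists by an argument of Alon, Seymour and Thomas: for every \<open>q\<close>, some connected
  set of at most \<open>q\<close> vertices is adjacent to all the \<open>U\<^sub>b\<close>, or at most \<open>(s - 1) n / (q + 1)\<close>
  vertices meet all connected sets with this property. Since \<open>G\<close> has no \<open>K\<^sup>*\<^sub>s\<^sub>,\<^sub>t\<close> minor, after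
  removing at most \<open>t - 1\<close> disjoint connected sets of the first kind the second case applies.
  Taking \<open>q\<close> to be the integer part of \<open>sqrt ((s - 1) n / (t - 1))\<close> balances the two
  contributions to \<open>Y\<close>.
\<close>

section \<open>Connected vertex sets\<close>

text \<open>Connectedness without walks: no proper nonempty subset of \<open>S\<close> is closed
  under the edges inside \<open>S\<close>. For symmetric \<open>E\<close> this is the usual notion,
  and it turns proofs along a walk into closure arguments.\<close>

definition conn :: "('a \<times> 'a) set \<Rightarrow> 'a set \<Rightarrow> bool" where
  "conn E S \<longleftrightarrow> S \<noteq> {} \<and>
     (\<forall>X \<subseteq> S. X \<noteq> {} \<longrightarrow> (\<forall>x \<in> X. \<forall>y \<in> S. (x, y) \<in> E \<longrightarrow> y \<in> X) \<longrightarrow> X = S)"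

definition touch :: "('a \<times> 'a) set \<Rightarrow> 'a set \<Rightarrow> 'a set \<Rightarrow> bool" where
  "touch E S T \<longleftrightarrow> (\<exists>x \<in> S. \<exists>y \<in> T. (x, y) \<in> E)"

definition is_comp :: "('a \<times> 'a) set \<Rightarrow> 'a set \<Rightarrow> 'a set \<Rightarrow> bool" where
  "is_comp E R C \<longleftrightarrow> C \<subseteq> R \<and> conn E C \<and> (\<forall>x \<in> C. \<forall>y \<in> R. (x, y) \<in> E \<longrightarrow> y \<in> C)"

lemma connI:
  assumes "S \<noteq> {}"
    and "\<And>X. X \<subseteq> S \<Longrightarrow> X \<noteq> {} \<Longrightarrow> (\<And>x y. x \<in> X \<Longrightarrow> y \<in> S \<Longrightarrow> (x, y) \<in> E \<Longrightarrow> y \<in> X) \<Longrightarrow> S \<subseteq> X"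
  shows "conn E S"
  unfolding conn_def using assms by (meson subset_antisym)

lemma connD:
  assumes "conn E S" "X \<subseteq> S" "X \<noteq> {}" "\<And>x y. x \<in> X \<Longrightarrow> y \<in> S \<Longrightarrow> (x, y) \<in> E \<Longrightarrow> y \<in> X"
  shows "X = S"
  using assms unfolding conn_def by blast

lemma conn_induct [consumes 3, case_names base step]:
  assumes "conn E S" "v \<in> S" "w \<in> S" "P v"
    and step: "\<And>x y. x \<in> S \<Longrightarrow> P x \<Longrightarrow> y \<in> S \<Longrightarrow> (x, y) \<in> E \<Longrightarrow> P y"
  shows "P w"
proof -
  have "{x \<in> S. P x} = S"
  proof (rule connD[OF assms(1)])
    show "{x \<in> S. P x} \<noteq> {}" using assms(2,4) by blast
  qed (use step in blast)+
  with \<open>w \<in> S\<close> show ?thesis by blast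
qed

lemma conn_nonempty: "conn E S \<Longrightarrow> S \<noteq> {}"
  by (simp add: conn_def)

lemma conn_singleton: "conn E {x}"
  by (rule connI) auto

text \<open>A closed nonempty subset of the union swallows a member that it meets, hence contains
  the common vertex \<open>x\<close>, hence meets and swallows every member.\<close>

lemma conn_Union:
  assumes "\<F> \<noteq> {}" "\<And>S. S \<in> \<F> \<Longrightarrow> conn E S \<and> x \<in> S"
  shows "conn E (\<Union>\<F>)"
proof (rule connI)
  show "\<Union>\<F> \<noteq> {}" using assms by blast
next
  fix X assume X: "X \<subseteq> \<Union>\<F>" "X \<noteq> {}"
    and closed: "\<And>x y. x \<in> X \<Longrightarrow> y \<in> \<Union>\<F> \<Longrightarrow> (x, y) \<in> E \<Longrightarrow> y \<in> X"
  have sub: "S \<subseteq> X" if "S \<in> \<F>" "S \<inter> X \<noteq> {}" for S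
  proof -
    have "S \<inter> X = S"
      by (rule connD[of E S]) (use that assms closed in blast)+
    then show ?thesis by blast
  qed
  obtain S where "S \<in> \<F>" "S \<inter> X \<noteq> {}" using X by blast
  then have "x \<in> X" using sub assms by blast
  then show "\<Union>\<F> \<subseteq> X" using sub assms by blast
qed

lemma conn_insert:
  assumes "sym E" "conn E S" "x \<in> S" "(x, y) \<in> E"
  shows "conn E (insert y S)"
proof -
  have "conn E {x, y}"
    by (rule connI) (use assms in \<open>auto dest: symD\<close>)
  then have "conn E (\<Union>{S, {x, y}})"
    using assms by (intro conn_Union[where x = x]) auto
  moreover have "\<Union>{S, {x, y}} = insert y S" using assms by auto
  ultimately show ?thesis by simp
qed

text \<open>The component is the union of all connected subsets of \<open>R\<close> through one
  vertex of \<open>S\<close>; a vertex of \<open>R\<close> adjacent to this union could be added to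
  it, so it is already inside.\<close>

lemma ex_comp:
  assumes "sym E" "conn E S" "S \<subseteq> R"
  shows "\<exists>C. is_comp E R C \<and> S \<subseteq> C"
proof -
  obtain x where x: "x \<in> S" using assms by (auto simp: conn_def)
  define \<F> where "\<F> = {S. S \<subseteq> R \<and> conn E S \<and> x \<in> S}"
  have S: "S \<in> \<F>" using assms x by (simp add: \<F>_def)
  have c: "conn E (\<Union>\<F>)"
    by (rule conn_Union[where x = x]) (use S in \<open>auto simp: \<F>_def\<close>)
  have "z \<in> \<Union>\<F>" if "y \<in> \<Union>\<F>" "z \<in> R" "(y, z) \<in> E" for y z
  proof -
    have "insert z (\<Union>\<F>) \<in> \<F>"
      using conn_insert[OF assms(1) c that(1,3)] that(2) S x by (auto simp: \<F>_def)
    then show ?thesis by blast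
  qed
  moreover have "\<Union>\<F> \<subseteq> R" by (auto simp: \<F>_def)
  ultimately have "is_comp E R (\<Union>\<F>)" using c by (simp add: is_comp_def)
  with S show ?thesis by blast
qed

lemma conn_subset_comp:
  assumes "is_comp E R C" "conn E S" "S \<subseteq> R" "S \<inter> C \<noteq> {}"
  shows "S \<subseteq> C"
proof -
  have "S \<inter> C = S"
    by (rule connD[OF assms(2)]) (use assms in \<open>auto simp: is_comp_def\<close>)
  then show ?thesis by blast
qed

text \<open>Descending along \<open>f\<close> from any vertex ends at \<open>r\<close>, so a
  nonempty closed set contains \<open>r\<close>; along the reverse edges it then contains every
  vertex. This serves for whole trees and for the subtrees of a tree decomposition.\<close>

lemma conn_parent_function:
  fixes S :: "nat set"
  assumes "r \<in> S"
    and "\<And>x. x \<in> S \<Longrightarrow> x \<noteq> r \<Longrightarrow> f x \<in> S \<and> f x < x \<and> (x, f x) \<in> E \<and> (f x, x) \<in> E"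
  shows "conn E S"
proof (rule connI)
  show "S \<noteq> {}" using assms by blast
next
  fix X assume X: "X \<subseteq> S" "X \<noteq> {}"
    and closed: "\<And>x y. x \<in> X \<Longrightarrow> y \<in> S \<Longrightarrow> (x, y) \<in> E \<Longrightarrow> y \<in> X"
  have "x \<in> X \<Longrightarrow> r \<in> X" for x
  proof (induction x rule: less_induct)
    case (less x)
    then show ?case using assms(2)[of x] closed X by (cases "x = r") blast+
  qed
  then have r: "r \<in> X" using X by blast
  have "x \<in> S \<Longrightarrow> x \<in> X" for x
  proof (induction x rule: less_induct)
    case (less x)
    then show ?case using assms(2)[of x] closed r by (cases "x = r") blast+
  qed
  then show "S \<subseteq> X" by blast
qed

section \<open>Agreement with connectedness by reachability\<close>

text \<open>In a symmetric graph the symmetric closure taken by the library definition adds no arcs,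
  so its connectedness is reachability inside \<open>S\<close>. Induction along walks translates
  between reachability and closed sets.\<close>

lemma connected_in_iff_conn:
  assumes "pair_graph G"
  shows "connected_in G S \<longleftrightarrow> conn (parcs G) S"
proof -
  interpret pair_graph G by fact
  let ?H = "mk_symmetric (with_proj G \<restriction> S)"
  have v: "verts (with_proj ?H) = S" by (simp add: mk_symmetric_def)
  have a: "arcs_ends (with_proj ?H) = parcs G \<inter> S \<times> S"
    by (auto simp: mk_symmetric_def dest: arcs_symmetric)
  have "(\<forall>u \<in> S. \<forall>v \<in> S. u \<rightarrow>\<^sup>*\<^bsub>with_proj ?H\<^esub> v) \<longleftrightarrow> conn (parcs G) S" if "S \<noteq> {}"
  proof
    assume R: "\<forall>u \<in> S. \<forall>v \<in> S. u \<rightarrow>\<^sup>*\<^bsub>with_proj ?H\<^esub> v"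
    show "conn (parcs G) S"
    proof (rule connI[OF that], rule subsetI)
      fix X w assume X: "X \<subseteq> S" "X \<noteq> {}"
        and closed: "\<And>x y. x \<in> X \<Longrightarrow> y \<in> S \<Longrightarrow> (x, y) \<in> parcs G \<Longrightarrow> y \<in> X" and "w \<in> S"
      then obtain u where u: "u \<in> X" "u \<in> S" by blast
      then have "(u, w) \<in> rtrancl_on S (parcs G \<inter> S \<times> S)"
        using R \<open>w \<in> S\<close> unfolding reachable_def v a by blast
      then show "w \<in> X"
        by (induction rule: rtrancl_on_induct) (use u closed in auto)
    qed
  next
    assume C: "conn (parcs G) S"
    show "\<forall>u \<in> S. \<forall>v \<in> S. u \<rightarrow>\<^sup>*\<^bsub>with_proj ?H\<^esub> v"
    proof (intro ballI)
      fix u w assume "u \<in> S" "w \<in> S"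
      from C \<open>u \<in> S\<close> \<open>w \<in> S\<close> have "(u, w) \<in> rtrancl_on S (parcs G \<inter> S \<times> S)"
      proof (induction rule: conn_induct)
        case base
        show ?case using \<open>u \<in> S\<close> by auto
      next
        case (step x y)
        then show ?case by (auto intro: rtrancl_on_into_rtrancl_on)
      qed
      then show "u \<rightarrow>\<^sup>*\<^bsub>with_proj ?H\<^esub> w" unfolding reachable_def v a .
    qed
  qed
  then show ?thesis
    unfolding Digraph_Component.connected_def strongly_connected_def v
    by (auto simp: conn_def)
qed

lemma connected_graph_iff_conn:
  assumes "pair_graph G"
  shows "connected_graph G \<longleftrightarrow> conn (parcs G) (pverts G)"
proof -
  interpret pair_graph G by fact
  have "with_proj G \<restriction> pverts G = with_proj G"
    unfolding induce_subgraph_def with_proj_def using wellformed' by auto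
  then show ?thesis using connected_in_iff_conn[OF assms, of "pverts G"] by simp
qed

section \<open>Small connected sets or small separators\<close>

lemma steiner_set_or_separator_nat:
  fixes A :: "nat \<Rightarrow> 'a set"
  assumes "sym E" and fin: "finite C" and k: "k \<ge> 2"
  shows "(\<exists>T \<subseteq> C. conn E T \<and> card T \<le> q \<and> (\<forall>i<k. T \<inter> A i \<noteq> {})) \<or>
         (\<exists>X \<subseteq> C. card X * (q + 1) \<le> (k - 1) * card C \<and>
            (\<forall>S \<subseteq> C - X. conn E S \<longrightarrow> (\<exists>i<k. S \<inter> A i = {})))"
proof -
  \<comment> \<open>The least \<open>j\<close> with \<open>P i j v\<close> is the Steiner distance of \<open>v\<close> to the first \<open>i\<close> sets. It changes
    by at most one along an edge, so a level set of it separates.\<close>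
  define P where "P i j v \<longleftrightarrow>
    (\<exists>T \<subseteq> C. v \<in> T \<and> conn E T \<and> card T \<le> j \<and> (\<forall>l<i. T \<inter> A l \<noteq> {}))" for i j v
  have PI: "P i j v"
    if "T \<subseteq> C" "v \<in> T" "conn E T" "card T \<le> j" "\<forall>l<i. T \<inter> A l \<noteq> {}" for T i j v
    unfolding P_def using that by (intro exI[of _ T] conjI)
  \<comment> \<open>A pair \<open>(i, v)\<close> is in \<open>Z j\<close> when the distance of
    \<open>v\<close> to the first \<open>i\<close> sets is exactly \<open>j + 1\<close>. The value
    \<open>i = k\<close> is left out because the last set will be met by the choice of
    \<open>v\<close>; hence the factor \<open>k - 1\<close>.\<close>
  define Z where "Z j = {(i, v). i \<in> {1..<k} \<and> v \<in> C \<and> P i (Suc j) v \<and> \<not> P i j v}" for j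
  have mono: "P i j v \<Longrightarrow> j \<le> j' \<Longrightarrow> P i j' v" for i j j' v
    unfolding P_def by (meson order_trans)
  have Z_sub: "Z j \<subseteq> {1..<k} \<times> C" for j by (auto simp: Z_def)
  have finZ: "finite (Z j)" for j
    by (rule finite_subset[OF Z_sub]) (simp add: fin)
  have disj: "Z j \<inter> Z j' = {}" if "j < j'" for j j'
  proof -
    have "Suc j \<le> j'" using that by simp
    then show ?thesis using mono unfolding Z_def by blast
  qed
  have "(\<Sum>j\<le>q. card (Z j)) = card (\<Union>j\<le>q. Z j)"
  proof (rule card_UN_disjoint[symmetric])
    show "\<forall>j\<in>{..q}. \<forall>j'\<in>{..q}. j \<noteq> j' \<longrightarrow> Z j \<inter> Z j' = {}"
      using disj by (metis Int_commute linorder_neq_iff)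
  qed (use finZ in auto)
  also have "\<dots> \<le> card ({1..<k} \<times> C)"
    by (rule card_mono) (use fin Z_sub in auto)
  finally have sum: "(\<Sum>j\<le>q. card (Z j)) \<le> (k - 1) * card C"
    by (simp add: card_cartesian_product)
  \<comment> \<open>Averaging: the \<open>q + 1\<close> disjoint layers share at most
    \<open>(k - 1) * card C\<close> pairs.\<close>
  have "\<exists>j\<le>q. card (Z j) * (q + 1) \<le> (k - 1) * card C"
  proof (rule ccontr)
    assume "\<not> ?thesis"
    then have "(k - 1) * card C < card (Z j) * (q + 1)" if "j \<le> q" for j
      using that by (meson not_le)
    then have "(\<Sum>j\<le>q. (k - 1) * card C) < (\<Sum>j\<le>q. card (Z j) * (q + 1))"
      by (intro sum_strict_mono) auto
    also have "\<dots> = (\<Sum>j\<le>q. card (Z j)) * (q + 1)"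
      by (rule sum_distrib_right[symmetric])
    also have "\<dots> \<le> ((k - 1) * card C) * (q + 1)"
      using sum by (rule mult_right_mono) simp
    finally show False by simp
  qed
  then obtain j where j: "j \<le> q" "card (Z j) * (q + 1) \<le> (k - 1) * card C" by blast
  define X where "X = snd ` Z j"
  have "card X \<le> card (Z j)" unfolding X_def using finZ by (rule card_image_le)
  then have "card X * (q + 1) \<le> card (Z j) * (q + 1)" by (rule mult_right_mono) simp
  with j(2) have cardX: "card X * (q + 1) \<le> (k - 1) * card C" by linarith
  have XC: "X \<subseteq> C" using Z_sub unfolding X_def by force
  \<comment> \<open>Outside \<open>X\<close> no distance is exactly \<open>j + 1\<close>, so a bound
    of \<open>j + 1\<close> improves to \<open>j\<close>.\<close>
  have drop: "P i j v" if "P i (Suc j) v" "v \<in> C - X" "i \<in> {1..<k}" for i v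
  proof (rule ccontr)
    assume "\<not> P i j v"
    then have "(i, v) \<in> Z j" using that by (simp add: Z_def)
    then have "v \<in> X" unfolding X_def by force
    with that show False by blast
  qed
  show ?thesis
  proof (rule disjCI)
    assume "\<not> (\<exists>X \<subseteq> C. card X * (q + 1) \<le> (k - 1) * card C \<and>
            (\<forall>S \<subseteq> C - X. conn E S \<longrightarrow> (\<exists>i<k. S \<inter> A i = {})))"
    then have "\<not> (\<forall>S \<subseteq> C - X. conn E S \<longrightarrow> (\<exists>i<k. S \<inter> A i = {}))"
      using XC cardX by metis
    then obtain S where S: "S \<subseteq> C - X" "conn E S" "\<forall>i<k. S \<inter> A i \<noteq> {}"
      by metis
    \<comment> \<open>Moving to a neighbour costs one vertex, and \<open>drop\<close> regains it, so
      the bound \<open>j\<close> spreads over the whole connected set \<open>S\<close>.\<close>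
    have spread: "P i j w" if i: "i \<in> {1..<k}" and v: "v \<in> S" "P i (Suc j) v" and w: "w \<in> S" for i v w
      using S(2) v(1) w
    proof (induction rule: conn_induct)
      case base
      show ?case using drop v S(1) i by blast
    next
      case (step x y)
      obtain T where T: "T \<subseteq> C" "x \<in> T" "conn E T" "card T \<le> j" "\<forall>l<i. T \<inter> A l \<noteq> {}"
        using step unfolding P_def by blast
      have "card (insert y T) \<le> Suc j"
        using T(4) finite_subset[OF T(1) fin] by (simp add: card_insert_if)
      moreover have "conn E (insert y T)"
        using conn_insert[OF \<open>sym E\<close> T(3,2) \<open>(x, y) \<in> E\<close>] .
      moreover have "insert y T \<subseteq> C" using T(1) \<open>y \<in> S\<close> S(1) by blast
      moreover have "\<forall>l<i. insert y T \<inter> A l \<noteq> {}" using T(5) by auto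
      ultimately have "P i (Suc j) y" by (intro PI[of "insert y T"]) simp_all
      then show ?case using drop \<open>y \<in> S\<close> S(1) i by blast
    qed
    \<comment> \<open>Each new set \<open>A i\<close> is met at a vertex \<open>v\<close> of
      \<open>S\<close>: a tree through \<open>v\<close> for the earlier sets already meets
      \<open>A i\<close>, and the bound then spreads from \<open>v\<close>.\<close>
    have all: "i \<in> {1..<k} \<Longrightarrow> w \<in> S \<Longrightarrow> P i j w" for i w
    proof (induction i arbitrary: w)
      case 0
      then show ?case by simp
    next
      case (Suc i)
      obtain v where v: "v \<in> S" "v \<in> A i"
        using S(3)[rule_format, of i] Suc.prems(1) by auto
      \<comment> \<open>The bound is \<open>Suc j\<close> because for \<open>i = 0\<close> the
        witness \<open>{v}\<close> has one vertex, which is too many when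
        \<open>j = 0\<close>.\<close>
      have "P (Suc i) (Suc j) v"
      proof (cases "i = 0")
        case True
        have "{v} \<subseteq> C" using v S(1) by blast
        then show ?thesis using True v conn_singleton[of E v]
          by (intro PI[of "{v}"]) simp_all
      next
        case False
        then have "P i j v" using Suc v by simp
        then obtain T where "T \<subseteq> C" "v \<in> T" "conn E T" "card T \<le> j" "\<forall>l<i. T \<inter> A l \<noteq> {}"
          unfolding P_def by metis
        then show ?thesis using v(2) by (intro PI[of T]) (auto simp: less_Suc_eq)
      qed
      then show ?case using spread Suc.prems v by blast
    qed
    \<comment> \<open>A tree for the first \<open>k - 1\<close> sets through a vertex of the last
      set meets all \<open>k\<close> of them.\<close>
    obtain v where v: "v \<in> S" "v \<in> A (k - 1)"
      using S(3)[rule_format, of "k - 1"] k by auto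
    have "P (k - 1) j v" using all v k by simp
    then obtain T where T: "T \<subseteq> C" "v \<in> T" "conn E T" "card T \<le> j" "\<forall>l<k - 1. T \<inter> A l \<noteq> {}"
      unfolding P_def by metis
    have "T \<inter> A l \<noteq> {}" if "l < k" for l
      using that T(2,5) v(2) k by (cases "l = k - 1") auto
    with T j(1) show "\<exists>T \<subseteq> C. conn E T \<and> card T \<le> q \<and> (\<forall>i<k. T \<inter> A i \<noteq> {})"
      by (meson order_trans)
  qed
qed

lemma steiner_set_or_separator:
  fixes A :: "'b \<Rightarrow> 'a set"
  assumes "sym E" "finite C" "card Q \<ge> 2"
  shows "(\<exists>T \<subseteq> C. conn E T \<and> card T \<le> q \<and> (\<forall>i\<in>Q. T \<inter> A i \<noteq> {})) \<or>
         (\<exists>X \<subseteq> C. card X * (q + 1) \<le> (card Q - 1) * card C \<and>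
            (\<forall>S \<subseteq> C - X. conn E S \<longrightarrow> (\<exists>i\<in>Q. S \<inter> A i = {})))"
proof -
  have "finite Q" using assms(3) card.infinite by fastforce
  then obtain e where "bij_betw e {0..<card Q} Q" using ex_bij_betw_nat_finite by blast
  then have e: "Q = e ` {..<card Q}" by (simp add: bij_betw_def lessThan_atLeast0)
  have all: "(\<forall>i\<in>Q. R i) \<longleftrightarrow> (\<forall>i<card Q. R (e i))" for R by (subst e) auto
  have ex: "(\<exists>i\<in>Q. R i) \<longleftrightarrow> (\<exists>i<card Q. R (e i))" for R by (subst e) auto
  show ?thesis
    using steiner_set_or_separator_nat[OF assms, of q "\<lambda>i. A (e i)"] by (simp only: all ex)
qed

text \<open>Induction on \<open>r\<close>: delete the union of the sets found so far, at most
  \<open>r * q\<close> vertices, and apply the dichotomy to the rest. It yields a further disjoint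
  set, or its separator together with the deleted vertices hits everything. The factor
  \<open>r - 1\<close> bounds the number of sets found before the failure.\<close>

lemma packing_or_hitting_set:
  fixes A :: "'b \<Rightarrow> 'a set"
  assumes "sym E" "finite C" "card Q \<ge> 2"
  shows "(\<exists>F :: nat \<Rightarrow> 'a set.
            (\<forall>i<r. F i \<subseteq> C \<and> conn E (F i) \<and> card (F i) \<le> q \<and> (\<forall>b\<in>Q. F i \<inter> A b \<noteq> {})) \<and>
            (\<forall>i<r. \<forall>j<r. i \<noteq> j \<longrightarrow> F i \<inter> F j = {})) \<or>
         (\<exists>Y \<subseteq> C. \<exists>x. card Y \<le> (r - 1) * q + x \<and> x * (q + 1) \<le> (card Q - 1) * card C \<and>
            (\<forall>S \<subseteq> C - Y. conn E S \<longrightarrow> (\<exists>b\<in>Q. S \<inter> A b = {})))"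
proof (induction r)
  case 0
  show ?case by simp
next
  case (Suc r)
  then show ?case
  proof (elim disjE exE conjE)
    fix F :: "nat \<Rightarrow> 'a set"
    assume F: "\<forall>i<r. F i \<subseteq> C \<and> conn E (F i) \<and> card (F i) \<le> q \<and> (\<forall>b\<in>Q. F i \<inter> A b \<noteq> {})"
      and disj: "\<forall>i<r. \<forall>j<r. i \<noteq> j \<longrightarrow> F i \<inter> F j = {}"
    define W where "W = (\<Union>i<r. F i)"
    have WC: "W \<subseteq> C" using F by (auto simp: W_def)
    have "card W \<le> (\<Sum>i<r. card (F i))" unfolding W_def by (rule card_UN_le) simp
    also have "\<dots> \<le> (\<Sum>i<r. q)" using F by (intro sum_mono) simp
    finally have cW: "card W \<le> r * q" by simp
    have fin: "finite (C - W)" using assms(2) by simp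
    from steiner_set_or_separator[OF assms(1) fin assms(3), of q A] show ?thesis
    proof (elim disjE exE conjE)
      fix T assume T: "T \<subseteq> C - W" "conn E T" "card T \<le> q" "\<forall>i\<in>Q. T \<inter> A i \<noteq> {}"
      have TF: "T \<inter> F i = {}" if "i < r" for i using T(1) that by (auto simp: W_def)
      show ?thesis
      proof (intro disjI1 exI[of _ "F(r := T)"] conjI allI impI)
        fix i assume i: "i < Suc r"
        have "T \<subseteq> C" using T(1) by blast
        with F T have *: "\<forall>i<Suc r. (F(r := T)) i \<subseteq> C \<and> conn E ((F(r := T)) i) \<and>
            card ((F(r := T)) i) \<le> q \<and> (\<forall>b\<in>Q. (F(r := T)) i \<inter> A b \<noteq> {})"
          by (auto simp: less_Suc_eq)
        with i show "(F(r := T)) i \<subseteq> C" "conn E ((F(r := T)) i)" "card ((F(r := T)) i) \<le> q"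
            "\<forall>b\<in>Q. (F(r := T)) i \<inter> A b \<noteq> {}"
          by blast+
      next
        fix i j assume "i < Suc r" "j < Suc r" "i \<noteq> j"
        then show "(F(r := T)) i \<inter> (F(r := T)) j = {}"
          using TF disj by (cases "i = r"; cases "j = r") (auto simp: less_Suc_eq Int_commute)
      qed
    next
      fix X assume X: "X \<subseteq> C - W" "card X * (q + 1) \<le> (card Q - 1) * card (C - W)"
        "\<forall>S \<subseteq> C - W - X. conn E S \<longrightarrow> (\<exists>i\<in>Q. S \<inter> A i = {})"
      have "card (W \<union> X) \<le> card W + card X" by (rule card_Un_le)
      then have "card (W \<union> X) \<le> (Suc r - 1) * q + card X" using cW by simp
      moreover have "(card Q - 1) * card (C - W) \<le> (card Q - 1) * card C"
        using assms(2) by (intro mult_left_mono card_mono) auto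
      then have "card X * (q + 1) \<le> (card Q - 1) * card C" using X(2) by linarith
      moreover have "C - (W \<union> X) = C - W - X" by blast
      moreover have "W \<union> X \<subseteq> C" using WC X(1) by blast
      ultimately show ?thesis using X(3) by (intro disjI2) metis
    qed
  next
    \<comment> \<open>A hitting set from an earlier stage stays valid, since the bound only grows
      with \<open>r\<close>.\<close>
    fix Y x assume Y: "Y \<subseteq> C" "card Y \<le> (r - 1) * q + x" "x * (q + 1) \<le> (card Q - 1) * card C"
      "\<forall>S \<subseteq> C - Y. conn E S \<longrightarrow> (\<exists>b\<in>Q. S \<inter> A b = {})"
    have "(r - 1) * q \<le> (Suc r - 1) * q" by (rule mult_right_mono) auto
    then have "card Y \<le> (Suc r - 1) * q + x" using Y(2) by linarith
    with Y show ?thesis by blast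
  qed
qed

section \<open>Partitions guarded by clique models\<close>

definition clique_model :: "('a \<times> 'a) set \<Rightarrow> 'b set \<Rightarrow> ('b \<Rightarrow> 'a set) \<Rightarrow> bool" where
  "clique_model E Q U \<longleftrightarrow> (\<forall>i\<in>Q. conn E (U i)) \<and>
     (\<forall>i\<in>Q. \<forall>j\<in>Q. i \<noteq> j \<longrightarrow> U i \<inter> U j = {} \<and> touch E (U i) (U j))"

text \<open>When every \<open>j\<close> is joined to the members of \<open>B j\<close>, these
  \<open>Q\<close> are the cliques.\<close>

definition back_clique :: "(nat \<Rightarrow> nat set) \<Rightarrow> nat set \<Rightarrow> bool" where
  "back_clique B Q \<longleftrightarrow> (\<forall>i\<in>Q. \<forall>j\<in>Q. i < j \<longrightarrow> i \<in> B j)"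

text \<open>
  \<open>\<phi>\<close> maps a vertex to the number of its part, \<open>N\<close> is the number of parts so far, and \<open>B i\<close> is the
  set of earlier parts that were guarding the component from which part \<open>i\<close> was taken. The sets
  \<open>U i\<close> may be much larger than the parts and may contain vertices without a part.
\<close>

definition guarded :: "'a set \<Rightarrow> ('a \<times> 'a) set \<Rightarrow> nat \<Rightarrow> nat \<Rightarrow> ('a \<Rightarrow> nat) \<Rightarrow> (nat \<Rightarrow> nat set)
    \<Rightarrow> 'a set \<Rightarrow> nat set \<Rightarrow> (nat \<Rightarrow> 'a set) \<Rightarrow> bool" where
  "guarded V E s N \<phi> B C Q U \<longleftrightarrow>
     Q \<subseteq> {..<N} \<and> card Q \<le> s \<and> back_clique B Q \<and> clique_model E Q U \<and>
     (\<forall>i\<in>Q. U i \<subseteq> V - C) \<and>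
     (\<forall>v\<in>C. \<forall>w\<in>V - C. (v, w) \<in> E \<longrightarrow> \<phi> w \<in> Q \<and> w \<in> U (\<phi> w))"

text \<open>This is a construction order of a chordal graph, that is, a reversed perfect elimination
  order: each new vertex is joined to a clique of at most \<open>s\<close> earlier ones.\<close>

definition back_structure :: "nat \<Rightarrow> nat \<Rightarrow> (nat \<Rightarrow> nat set) \<Rightarrow> bool" where
  "back_structure s N B \<longleftrightarrow> (\<forall>i<N. B i \<subseteq> {..<i} \<and> card (B i) \<le> s \<and> back_clique B (B i))"

text \<open>The invariant of the construction, where \<open>R\<close> holds the vertices still
  without a part. At \<open>R = {}\<close> it describes a partition of the whole graph whose
  quotient has its edges in the graph given by \<open>B\<close>.\<close>

definition partial_partition :: "'a set \<Rightarrow> ('a \<times> 'a) set \<Rightarrow> nat \<Rightarrow> nat \<Rightarrow> 'a set \<Rightarrow> nat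
    \<Rightarrow> ('a \<Rightarrow> nat) \<Rightarrow> (nat \<Rightarrow> nat set) \<Rightarrow> bool" where
  "partial_partition V E s M R N \<phi> B \<longleftrightarrow>
     R \<subseteq> V \<and> (\<forall>v\<in>V - R. \<phi> v < N) \<and> (\<forall>i<N. card {v \<in> V - R. \<phi> v = i} \<le> M) \<and>
     back_structure s N B \<and>
     (\<forall>v\<in>V - R. \<forall>w\<in>V - R. (v, w) \<in> E \<longrightarrow> \<phi> v = \<phi> w \<or> \<phi> v \<in> B (\<phi> w) \<or> \<phi> w \<in> B (\<phi> v)) \<and>
     (\<forall>C. is_comp E R C \<longrightarrow> (\<exists>Q U. guarded V E s N \<phi> B C Q U))"

lemma touch_sym: "sym E \<Longrightarrow> touch E S T \<longleftrightarrow> touch E T S"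
  unfolding touch_def by (meson symD)

lemma touch_mono: "touch E S T \<Longrightarrow> S \<subseteq> S' \<Longrightarrow> T \<subseteq> T' \<Longrightarrow> touch E S' T'"
  unfolding touch_def by blast

lemma back_clique_cong:
  assumes "\<And>i. i < N \<Longrightarrow> B i = B' i" "Q \<subseteq> {..<N}"
  shows "back_clique B Q \<longleftrightarrow> back_clique B' Q"
  using assms unfolding back_clique_def by (metis lessThan_iff subsetD)

section \<open>Adding one part to a partial partition\<close>

text \<open>No edge joins \<open>C\<close> to the rest of \<open>R\<close>, so deleting
  \<open>Y\<close> affects only the component \<open>C\<close>.\<close>

lemma comp_diff_cases:
  assumes "sym E" "is_comp E R C" "Y \<subseteq> C" "is_comp E (R - Y) D"
  shows "is_comp E R D \<and> D \<inter> C = {} \<or> is_comp E (C - Y) D"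
proof (cases "D \<inter> C = {}")
  case True
  have "y \<in> D" if "x \<in> D" "y \<in> R" "(x, y) \<in> E" for x y
  proof (cases "y \<in> C")
    case yC: True
    have "(y, x) \<in> E" using \<open>sym E\<close> that(3) by (rule symD)
    moreover have "x \<in> R" using assms(4) that(1) by (auto simp: is_comp_def)
    ultimately have "x \<in> C" using assms(2) yC unfolding is_comp_def by blast
    with True that(1) show ?thesis by blast
  next
    case False
    then have "y \<in> R - Y" using that(2) assms(3) by blast
    then show ?thesis using assms(4) that unfolding is_comp_def by blast
  qed
  then have "is_comp E R D" using assms(4) unfolding is_comp_def by auto
  with True show ?thesis by blast
next
  case False
  have D: "conn E D" "D \<subseteq> R - Y" using assms(4) by (auto simp: is_comp_def)
  then have "D \<subseteq> C" using conn_subset_comp[OF assms(2) D(1)] False by blast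
  moreover have "C \<subseteq> R" using assms(2) by (simp add: is_comp_def)
  ultimately have "is_comp E (C - Y) D" using assms(4) unfolding is_comp_def by blast
  then show ?thesis by blast
qed

text \<open>Only the components of \<open>C - Y\<close> need new guards. Every neighbour of
  \<open>Y\<close> that already has a part lies in a part from \<open>Q\<close>, so setting
  \<open>B N = Q\<close> accounts for all new edges between parts.\<close>

lemma extend_partial_partition:
  assumes "sym E" and fin: "finite V" and PP: "partial_partition V E s M R N \<phi> B"
    and C: "is_comp E R C" and gC: "guarded V E s N \<phi> B C Q U"
    and Y: "Y \<subseteq> C" "card Y \<le> M"
    and guard: "\<And>D. is_comp E (C - Y) D \<Longrightarrow>
      \<exists>Q' U'. guarded V E s (Suc N) (\<lambda>v. if v \<in> Y then N else \<phi> v) (B(N := Q)) D Q' U'"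
  shows "partial_partition V E s M (R - Y) (Suc N) (\<lambda>v. if v \<in> Y then N else \<phi> v) (B(N := Q))"
proof -
  let ?\<phi> = "\<lambda>v. if v \<in> Y then N else \<phi> v" and ?B = "B(N := Q)"
  have R: "R \<subseteq> V" and lt: "\<And>v. v \<in> V - R \<Longrightarrow> \<phi> v < N"
    and sz: "\<And>i. i < N \<Longrightarrow> card {v \<in> V - R. \<phi> v = i} \<le> M"
    and bs: "back_structure s N B"
    and edge: "\<And>v w. v \<in> V - R \<Longrightarrow> w \<in> V - R \<Longrightarrow> (v, w) \<in> E \<Longrightarrow>
        \<phi> v = \<phi> w \<or> \<phi> v \<in> B (\<phi> w) \<or> \<phi> w \<in> B (\<phi> v)"
    and gd: "\<And>C. is_comp E R C \<Longrightarrow> \<exists>Q U. guarded V E s N \<phi> B C Q U"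
    using PP unfolding partial_partition_def by auto
  have CR: "C \<subseteq> R" using C by (simp add: is_comp_def)
  have Q: "Q \<subseteq> {..<N}" "card Q \<le> s" "back_clique B Q"
    and out: "\<And>v w. v \<in> C \<Longrightarrow> w \<in> V - C \<Longrightarrow> (v, w) \<in> E \<Longrightarrow> \<phi> w \<in> Q"
    using gC unfolding guarded_def by auto
  have VR: "V - (R - Y) = (V - R) \<union> Y" using Y CR R by blast
  have bc: "back_clique ?B P \<longleftrightarrow> back_clique B P" if "P \<subseteq> {..<N}" for P
    by (rule back_clique_cong[of N]) (use that in auto)
  have "back_structure s (Suc N) ?B"
    unfolding back_structure_def
  proof (intro allI impI)
    fix i assume "i < Suc N"
    show "?B i \<subseteq> {..<i} \<and> card (?B i) \<le> s \<and> back_clique ?B (?B i)"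
    proof (cases "i = N")
      case True
      then show ?thesis using Q bc[of Q] by simp
    next
      case False
      then have i: "i < N" using \<open>i < Suc N\<close> by simp
      then have "B i \<subseteq> {..<i}" "card (B i) \<le> s" "back_clique B (B i)"
        using bs by (auto simp: back_structure_def)
      moreover from this i have "B i \<subseteq> {..<N}" by (meson lessThan_subset_iff less_imp_le order_trans)
      ultimately show ?thesis using bc[of "B i"] False by simp
    qed
  qed
  moreover have "?\<phi> v < Suc N" if "v \<in> V - (R - Y)" for v
    using that lt[of v] unfolding VR by (cases "v \<in> Y") auto
  moreover have "card {v \<in> V - (R - Y). ?\<phi> v = i} \<le> M" if "i < Suc N" for i
  proof (cases "i = N")
    case True
    have "{v \<in> V - (R - Y). ?\<phi> v = i} = Y"
      using True lt unfolding VR by (auto dest: lt)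
    then show ?thesis using Y by simp
  next
    case False
    have "{v \<in> V - (R - Y). ?\<phi> v = i} \<subseteq> {v \<in> V - R. \<phi> v = i}"
      using False unfolding VR by (auto split: if_splits)
    then have "card {v \<in> V - (R - Y). ?\<phi> v = i} \<le> card {v \<in> V - R. \<phi> v = i}"
      by (rule card_mono[rotated]) (use fin in simp)
    then show ?thesis using sz[of i] False that by simp
  qed
  moreover have "?\<phi> v = ?\<phi> w \<or> ?\<phi> v \<in> ?B (?\<phi> w) \<or> ?\<phi> w \<in> ?B (?\<phi> v)"
    if v: "v \<in> V - (R - Y)" and w: "w \<in> V - (R - Y)" and e: "(v, w) \<in> E" for v w
  proof -
    have e': "(w, v) \<in> E" using \<open>sym E\<close> e by (rule symD)
    consider "v \<in> Y" "w \<in> Y" | "v \<in> Y" "w \<notin> Y" "w \<in> V - R" | "v \<notin> Y" "v \<in> V - R" "w \<in> Y"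
      | "v \<notin> Y" "w \<notin> Y" "v \<in> V - R" "w \<in> V - R"
      using v w unfolding VR by blast
    then show ?thesis
    proof cases
      case 1
      then show ?thesis by simp
    next
      case 2
      then show ?thesis using out[of v w] e Y CR by auto
    next
      case 3
      then show ?thesis using out[of w v] e' Y CR by auto
    next
      case 4
      then show ?thesis using edge[of v w] e lt[of v] lt[of w] by simp
    qed
  qed
  moreover have "\<exists>Q' U'. guarded V E s (Suc N) ?\<phi> ?B D Q' U'" if D: "is_comp E (R - Y) D" for D
    using comp_diff_cases[OF \<open>sym E\<close> C Y(1) D]
  proof
    assume "is_comp E (C - Y) D"
    then show ?thesis by (rule guard)
  next
    assume D': "is_comp E R D \<and> D \<inter> C = {}"
    obtain Q' U' where g: "guarded V E s N \<phi> B D Q' U'" using gd D' by metis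
    \<comment> \<open>As a component of \<open>R\<close> disjoint from \<open>C\<close>, the set
      \<open>D\<close> has no neighbour in \<open>Y\<close>, so the renumbering on \<open>Y\<close>
      does not disturb its guard.\<close>
    have "w \<notin> Y" if "v \<in> D" "w \<in> V - D" "(v, w) \<in> E" for v w
      using D' Y CR that unfolding is_comp_def by blast
    moreover have "Q' \<subseteq> {..<N}" using g by (simp add: guarded_def)
    then have "Q' \<subseteq> {..<Suc N}" "back_clique ?B Q' \<longleftrightarrow> back_clique B Q'"
      using bc by auto
    ultimately have "guarded V E s (Suc N) ?\<phi> ?B D Q' U'"
      using g unfolding guarded_def by simp
    then show ?thesis by metis
  qed
  moreover have "R - Y \<subseteq> V" using R by blast
  ultimately show ?thesis unfolding partial_partition_def by (intro conjI ballI allI impI) (simp_all only:)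
qed

text \<open>Common to both kinds of new part. In the first kind \<open>P = Q\<close> and
  \<open>W = Y\<close>; in the second \<open>P\<close> is \<open>Q\<close> without the index
  \<open>b\<close> of a set not adjacent to \<open>D\<close>, and \<open>W\<close> is the enlarged
  \<open>U b\<close>.\<close>

lemma guarded_insert:
  assumes gC: "guarded V E s N \<phi> B C Q U" and "sym E" and D: "is_comp E (C - Y) D"
    and P: "P \<subseteq> Q" "card P < s"
    and W: "conn E W" "W \<subseteq> V - D" "Y \<subseteq> W"
      "\<And>i. i \<in> P \<Longrightarrow> W \<inter> U i = {}" "\<And>i. i \<in> P \<Longrightarrow> touch E W (U i)"
    and nb: "\<And>v w. v \<in> D \<Longrightarrow> w \<in> V - C \<Longrightarrow> (v, w) \<in> E \<Longrightarrow> \<phi> w \<in> P"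
    and "Y \<subseteq> C"
  shows "guarded V E s (Suc N) (\<lambda>v. if v \<in> Y then N else \<phi> v) (B(N := Q)) D
    (insert N P) (U(N := W))"
proof -
  have Q: "Q \<subseteq> {..<N}" "back_clique B Q" "clique_model E Q U" "\<forall>i\<in>Q. U i \<subseteq> V - C"
    and out: "\<And>v w. v \<in> C \<Longrightarrow> w \<in> V - C \<Longrightarrow> (v, w) \<in> E \<Longrightarrow> \<phi> w \<in> Q \<and> w \<in> U (\<phi> w)"
    using gC unfolding guarded_def by auto
  have DC: "D \<subseteq> C - Y" using D by (simp add: is_comp_def)
  have lt: "i < N" if "i \<in> P" for i using that P(1) Q(1) by blast
  have finP: "finite P" using P(1) Q(1) by (meson finite_lessThan finite_subset order_trans)
  have "insert N P \<subseteq> {..<Suc N}" using lt by fastforce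
  moreover have "card (insert N P) \<le> s" using P(2) finP by (simp add: card_insert_if)
  moreover have "back_clique (B(N := Q)) (insert N P)"
    unfolding back_clique_def
  proof (intro ballI impI)
    fix i j assume ij: "i \<in> insert N P" "j \<in> insert N P" "i < j"
    show "i \<in> (B(N := Q)) j"
    proof (cases "j = N")
      case True
      then show ?thesis using ij P(1) by auto
    next
      case False
      then have "j \<in> P" "i \<in> P" using ij lt[of j] by auto
      then show ?thesis using False Q(2) P(1) ij(3) unfolding back_clique_def by auto
    qed
  qed
  moreover have "clique_model E (insert N P) (U(N := W))"
  proof -
    have 1: "conn E (U i)" if "i \<in> P" for i
      using Q(3) that P(1) unfolding clique_model_def by blast
    have 2: "U i \<inter> U j = {} \<and> touch E (U i) (U j)" if "i \<in> P" "j \<in> P" "i \<noteq> j" for i j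
      using Q(3) that P(1) unfolding clique_model_def by blast
    have 3: "touch E (U i) W" if "i \<in> P" for i
      using W(5) that touch_sym[OF \<open>sym E\<close>] by metis
    show ?thesis unfolding clique_model_def
    proof (intro conjI ballI impI)
      fix i assume "i \<in> insert N P"
      then show "conn E ((U(N := W)) i)" using 1 W(1) by auto
    next
      fix i j assume "i \<in> insert N P" "j \<in> insert N P" "i \<noteq> j"
      then show "(U(N := W)) i \<inter> (U(N := W)) j = {}" "touch E ((U(N := W)) i) ((U(N := W)) j)"
        using 2[of i j] 3 W(4,5) by (auto simp: Int_commute)
    qed
  qed
  moreover have "(U(N := W)) i \<subseteq> V - D" if "i \<in> insert N P" for i
  proof (cases "i = N")
    case True
    then show ?thesis using W(2) by simp
  next
    case False
    then have "U i \<subseteq> V - C" using that Q(4) P(1) by auto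
    then show ?thesis using False DC by auto
  qed
  moreover have "(if w \<in> Y then N else \<phi> w) \<in> insert N P \<and>
      w \<in> (U(N := W)) (if w \<in> Y then N else \<phi> w)"
    if vw: "v \<in> D" "w \<in> V - D" "(v, w) \<in> E" for v w
  proof (cases "w \<in> Y")
    case True
    then show ?thesis using W(3) by auto
  next
    case False
    have "w \<notin> C" using vw D False unfolding is_comp_def by blast
    then have "w \<in> V - C" "v \<in> C" using vw DC by auto
    then have "\<phi> w \<in> P" "w \<in> U (\<phi> w)" using nb[of v w] out[of v w] vw by auto
    then show ?thesis using False lt[of "\<phi> w"] by auto
  qed
  ultimately show ?thesis unfolding guarded_def by (intro conjI ballI impI) (simp_all only:)
qed

text \<open>All counting is packed into the hypothesis \<open>sep\<close>, whose two cases provide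
  the two kinds of new part; what remains is to maintain the guarding cliques.\<close>

lemma partial_partition_step:
  assumes symE: "sym E" and fin: "finite V" and PP: "partial_partition V E s M R N \<phi> B"
    and "R \<noteq> {}"
    and sep: "\<And>C Q (U :: nat \<Rightarrow> 'a set). \<lbrakk>C \<subseteq> V; conn E C; finite Q; card Q \<le> s; clique_model E Q U;
      \<forall>i\<in>Q. U i \<subseteq> V - C; \<forall>i\<in>Q. touch E C (U i)\<rbrakk> \<Longrightarrow>
      (\<exists>T \<subseteq> C. conn E T \<and> card T \<le> M \<and> card Q < s \<and> (\<forall>i\<in>Q. touch E T (U i))) \<or>
      (\<exists>Y \<subseteq> C. card Y \<le> M \<and> (\<forall>S \<subseteq> C - Y. conn E S \<longrightarrow> (\<exists>i\<in>Q. \<not> touch E S (U i))))"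
  shows "\<exists>Y \<phi>' B'. Y \<subseteq> R \<and> Y \<noteq> {} \<and> partial_partition V E s M (R - Y) (Suc N) \<phi>' B'"
proof -
  obtain x where "x \<in> R" using \<open>R \<noteq> {}\<close> by blast
  then obtain C where C: "is_comp E R C" using ex_comp[OF symE conn_singleton, of x R] by blast
  have "R \<subseteq> V" using PP by (simp add: partial_partition_def)
  then have CV: "C \<subseteq> V" and CR: "C \<subseteq> R" and cC: "conn E C" using C by (auto simp: is_comp_def)
  have finC: "finite C" using CV fin finite_subset by blast
  obtain Q0 U where g0: "guarded V E s N \<phi> B C Q0 U"
    using PP C unfolding partial_partition_def by metis
  \<comment> \<open>Guards not adjacent to \<open>C\<close> are discarded: \<open>sep\<close> asks
    that \<open>C\<close> be adjacent to all of them.\<close>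
  define Q where "Q = {i \<in> Q0. touch E C (U i)}"
  have gC: "guarded V E s N \<phi> B C Q U"
  proof -
    have finQ0: "finite Q0" and cardQ0: "card Q0 \<le> s"
      using g0 finite_subset[of Q0 "{..<N}"] unfolding guarded_def by auto
    have "Q \<subseteq> Q0" by (auto simp: Q_def)
    then have "card Q \<le> s" using card_mono[OF finQ0] cardQ0 order_trans by blast
    moreover have "back_clique B Q" "clique_model E Q U" "Q \<subseteq> {..<N}" "\<forall>i\<in>Q. U i \<subseteq> V - C"
      using g0 unfolding guarded_def clique_model_def back_clique_def Q_def by auto
    moreover have "\<phi> w \<in> Q \<and> w \<in> U (\<phi> w)" if vw: "v \<in> C" "w \<in> V - C" "(v, w) \<in> E" for v w
    proof -
      have "\<phi> w \<in> Q0" "w \<in> U (\<phi> w)" using g0 vw unfolding guarded_def by auto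
      then show ?thesis using vw unfolding Q_def touch_def by blast
    qed
    ultimately show ?thesis unfolding guarded_def by (intro conjI ballI impI) (simp_all only:)
  qed
  have Q: "Q \<subseteq> {..<N}" "card Q \<le> s" "clique_model E Q U" "\<forall>i\<in>Q. U i \<subseteq> V - C"
    and out: "\<And>v w. v \<in> C \<Longrightarrow> w \<in> V - C \<Longrightarrow> (v, w) \<in> E \<Longrightarrow> \<phi> w \<in> Q \<and> w \<in> U (\<phi> w)"
    using gC unfolding guarded_def by auto
  have model: "U i \<inter> U j = {}" "touch E (U i) (U j)" if "i \<in> Q" "j \<in> Q" "i \<noteq> j" for i j
    using Q(3) that by (simp_all add: clique_model_def)
  have finQ: "finite Q" using finite_subset[OF Q(1)] by simp
  have touchC: "\<forall>i\<in>Q. touch E C (U i)" by (simp add: Q_def)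
  note ext = extend_partial_partition[OF symE fin PP C gC]
  from sep[OF CV cC finQ Q(2,3,4) touchC] show ?thesis
  proof (elim disjE exE conjE)
    fix T assume T: "T \<subseteq> C" "conn E T" "card T \<le> M" "card Q < s" "\<forall>i\<in>Q. touch E T (U i)"
    have "guarded V E s (Suc N) (\<lambda>v. if v \<in> T then N else \<phi> v) (B(N := Q)) D
        (insert N Q) (U(N := T))" if D: "is_comp E (C - T) D" for D
    proof (rule guarded_insert[OF gC symE D order_refl T(4,2)])
      have DC: "D \<subseteq> C - T" using D by (simp add: is_comp_def)
      then show "T \<subseteq> V - D" using T(1) CV by blast
      show "T \<inter> U i = {}" if "i \<in> Q" for i using that Q(4) T(1) by blast
      show "\<phi> w \<in> Q" if "v \<in> D" "w \<in> V - C" "(v, w) \<in> E" for v w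
        using out[of v w] that DC by blast
    qed (use T in auto)
    then have "partial_partition V E s M (R - T) (Suc N) (\<lambda>v. if v \<in> T then N else \<phi> v) (B(N := Q))"
      using ext[OF T(1,3)] by metis
    moreover have "T \<subseteq> R" "T \<noteq> {}" using T(1) CR conn_nonempty[OF T(2)] by auto
    ultimately show ?thesis by metis
  next
    define hits where "hits Y \<longleftrightarrow> Y \<subseteq> C \<and> card Y \<le> M \<and>
      (\<forall>S \<subseteq> C - Y. conn E S \<longrightarrow> (\<exists>i\<in>Q. \<not> touch E S (U i)))" for Y
    fix Y0 assume "Y0 \<subseteq> C" "card Y0 \<le> M"
      "\<forall>S \<subseteq> C - Y0. conn E S \<longrightarrow> (\<exists>i\<in>Q. \<not> touch E S (U i))"
    then have "hits Y0" by (simp add: hits_def)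
    \<comment> \<open>Minimum cardinality gives the inclusion-minimality that \<open>crit\<close>
      exploits.\<close>
    then obtain Y where Y: "hits Y" and least: "\<And>Z. hits Z \<Longrightarrow> card Y \<le> card Z"
      using ex_has_least_nat[of hits Y0 card] by blast
    have YC: "Y \<subseteq> C" and YM: "card Y \<le> M"
      and Yhit: "\<And>S. S \<subseteq> C - Y \<Longrightarrow> conn E S \<Longrightarrow> \<exists>i\<in>Q. \<not> touch E S (U i)"
      using Y unfolding hits_def by auto
    have finY: "finite Y" using YC finC finite_subset by blast
    \<comment> \<open>The connected set \<open>C\<close> itself is adjacent to every
      \<open>U i\<close>, so the empty set does not hit.\<close>
    have "Y \<noteq> {}" using Yhit[of C] cC touchC by auto
    have crit: "\<exists>S \<subseteq> C - (Y - {y}). conn E S \<and> (\<forall>i\<in>Q. touch E S (U i))" if "y \<in> Y" for y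
    proof -
      have less: "card (Y - {y}) < card Y" by (rule card_Diff1_less[OF finY that])
      then have "\<not> hits (Y - {y})" using least[of "Y - {y}"] by linarith
      moreover have "Y - {y} \<subseteq> C" "card (Y - {y}) \<le> M" using YC YM less by auto
      ultimately show ?thesis unfolding hits_def by metis
    qed
    have "\<exists>Q' U'. guarded V E s (Suc N) (\<lambda>v. if v \<in> Y then N else \<phi> v) (B(N := Q)) D Q' U'"
      if D: "is_comp E (C - Y) D" for D
    proof -
      have DC: "D \<subseteq> C - Y" and cD: "conn E D" using D by (auto simp: is_comp_def)
      obtain b where b: "b \<in> Q" "\<not> touch E D (U b)" using Yhit[OF DC cD] by blast
      have cUb: "conn E (U b)" and UbC: "U b \<subseteq> V - C"
        using Q(3,4) b(1) by (auto simp: clique_model_def)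
      \<comment> \<open>The enlarged guarding set is what can be reached from \<open>U b\<close>
        within \<open>C - D\<close> and \<open>U b\<close>. The other guarding sets lie outside
        \<open>C\<close> and are disjoint from \<open>U b\<close>, so \<open>W\<close> avoids
        them.\<close>
      obtain W where W: "is_comp E ((C - D) \<union> U b) W" "U b \<subseteq> W"
        using ex_comp[OF symE cUb, of "(C - D) \<union> U b"] by blast
      have WD: "W \<subseteq> (C - D) \<union> U b" using W(1) by (simp add: is_comp_def)
      \<comment> \<open>A connected set that is missed only because of \<open>y\<close> reaches \<open>U b\<close>; it cannot do so through
        \<open>D\<close>, which is closed in \<open>C - Y\<close>.\<close>
      have YW: "y \<in> W" if "y \<in> Y" for y
      proof (rule ccontr)
        assume "y \<notin> W"
        obtain S where S: "S \<subseteq> C - (Y - {y})" "conn E S" and all: "\<forall>i\<in>Q. touch E S (U i)"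
          using crit[OF \<open>y \<in> Y\<close>] by metis
        have "y \<in> S"
        proof (rule ccontr)
          assume "y \<notin> S"
          then have "S \<subseteq> C - Y" using S(1) by blast
          then show False using Yhit[of S] S(2) all by blast
        qed
        obtain a u where au: "a \<in> S" "u \<in> U b" "(a, u) \<in> E" using all b(1) unfolding touch_def by metis
        have "a \<notin> D" using b(2) au by (auto simp: touch_def)
        moreover have "(u, a) \<in> E" using symE au(3) by (rule symD)
        ultimately have "a \<in> W" using W au S(1) unfolding is_comp_def by blast
        have "S \<inter> W = S"
        proof (rule connD[OF S(2)])
          show "S \<inter> W \<noteq> {}" using au(1) \<open>a \<in> W\<close> by blast
        next
          fix z z' assume z: "z \<in> S \<inter> W" "z' \<in> S" "(z, z') \<in> E"
          \<comment> \<open>The set \<open>S\<close> meets \<open>Y\<close> at most in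
            \<open>y\<close>, and \<open>y\<close> is not in \<open>W\<close>. So \<open>z\<close>
            is a vertex of \<open>C - Y\<close> outside \<open>D\<close> and has no neighbour in
            \<open>D\<close>.\<close>
          have zC: "z \<in> C - Y" using z(1) S(1) \<open>y \<notin> W\<close> by blast
          have "z \<notin> D" using z(1) WD zC UbC by blast
          have "z' \<notin> D"
          proof
            assume "z' \<in> D"
            moreover have "(z', z) \<in> E" using symE z(3) by (rule symD)
            ultimately show False using D zC \<open>z \<notin> D\<close> unfolding is_comp_def by blast
          qed
          then have "z' \<in> (C - D) \<union> U b" using z(2) S(1) by blast
          then show "z' \<in> S \<inter> W" using W(1) z unfolding is_comp_def by blast
        qed blast
        with \<open>y \<in> S\<close> \<open>y \<notin> W\<close> show False by blast
      qed
      have "guarded V E s (Suc N) (\<lambda>v. if v \<in> Y then N else \<phi> v) (B(N := Q)) D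
        (insert N (Q - {b})) (U(N := W))"
      proof (rule guarded_insert[OF gC symE D])
        show "card (Q - {b}) < s" using Q(2) card_Diff1_less[OF finQ b(1)] by linarith
        show "conn E W" using W(1) by (simp add: is_comp_def)
        show "W \<subseteq> V - D" using WD UbC CV DC by blast
        show "Y \<subseteq> W" using YW by blast
        show "W \<inter> U i = {}" if "i \<in> Q - {b}" for i
        proof -
          have "U b \<inter> U i = {}" using that by (intro model b(1)) auto
          moreover have "U i \<inter> C = {}" using Q(4) that by blast
          ultimately show ?thesis using WD by blast
        qed
        show "touch E W (U i)" if "i \<in> Q - {b}" for i
        proof -
          have "touch E (U b) (U i)" using that by (intro model b(1)) auto
          then show ?thesis using W(2) by (rule touch_mono) simp
        qed
        show "\<phi> w \<in> Q - {b}" if "v \<in> D" "w \<in> V - C" "(v, w) \<in> E" for v w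
        proof -
          have "\<phi> w \<in> Q" "w \<in> U (\<phi> w)" using out[of v w] that DC by auto
          moreover have "\<phi> w \<noteq> b" using b(2) that \<open>w \<in> U (\<phi> w)\<close> by (auto simp: touch_def)
          ultimately show ?thesis by blast
        qed
      qed (use YC in auto)
      then show ?thesis by metis
    qed
    then have "partial_partition V E s M (R - Y) (Suc N) (\<lambda>v. if v \<in> Y then N else \<phi> v) (B(N := Q))"
      using ext[OF YC YM] by metis
    with YC CR \<open>Y \<noteq> {}\<close> show ?thesis by (metis subset_trans)
  qed
qed

text \<open>Each step places at least one vertex, so induction on the number of unplaced vertices
  ends at \<open>R = {}\<close>.\<close>

lemma ex_full_partition:
  assumes symE: "sym E" and fin: "finite V"
    and sep: "\<And>C Q (U :: nat \<Rightarrow> 'a set). \<lbrakk>C \<subseteq> V; conn E C; finite Q; card Q \<le> s; clique_model E Q U;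
      \<forall>i\<in>Q. U i \<subseteq> V - C; \<forall>i\<in>Q. touch E C (U i)\<rbrakk> \<Longrightarrow>
      (\<exists>T \<subseteq> C. conn E T \<and> card T \<le> M \<and> card Q < s \<and> (\<forall>i\<in>Q. touch E T (U i))) \<or>
      (\<exists>Y \<subseteq> C. card Y \<le> M \<and> (\<forall>S \<subseteq> C - Y. conn E S \<longrightarrow> (\<exists>i\<in>Q. \<not> touch E S (U i))))"
  shows "\<exists>N \<phi> B. N \<ge> 1 \<and> partial_partition V E s M {} N \<phi> B"
proof -
  have finish: "\<exists>N' \<phi>' B'. N' \<ge> 1 \<and> partial_partition V E s M {} N' \<phi>' B'"
    if "partial_partition V E s M R N \<phi> B" "N \<ge> 1" for R N \<phi> B
    using that
  proof (induction "card R" arbitrary: R N \<phi> B rule: less_induct)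
    case less
    show ?case
    proof (cases "R = {}")
      case True
      then show ?thesis using less.prems by metis
    next
      case False
      obtain Y \<phi>' B' where Y: "Y \<subseteq> R" "Y \<noteq> {}"
        and PP: "partial_partition V E s M (R - Y) (Suc N) \<phi>' B'"
      proof -
        have "\<exists>Y \<phi>' B'. Y \<subseteq> R \<and> Y \<noteq> {} \<and> partial_partition V E s M (R - Y) (Suc N) \<phi>' B'"
          by (rule partial_partition_step[OF symE fin less.prems(1) False]) (rule sep)
        then show ?thesis using that by metis
      qed
      have "R \<subseteq> V" using less.prems(1) by (simp add: partial_partition_def)
      then have "finite R" using fin finite_subset by blast
      then have "card (R - Y) < card R" using Y by (intro psubset_card_mono) auto
      then show ?thesis using less.hyps[OF _ PP] by simp
    qed
  qed
  \<comment> \<open>The empty part \<open>0\<close> keeps the final graph nonempty even if \<open>V\<close> is empty.\<close>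
  have "guarded V E s 1 (\<lambda>_. 0) (\<lambda>_. {}) C {} (\<lambda>_. {})" if "is_comp E V C" for C
    using that unfolding guarded_def clique_model_def back_clique_def is_comp_def by auto
  then have "\<exists>Q U. guarded V E s 1 (\<lambda>_. 0) (\<lambda>_. {}) C Q U" if "is_comp E V C" for C
    using that by blast
  then have "partial_partition V E s M V 1 (\<lambda>_. 0) (\<lambda>_. {})"
    unfolding partial_partition_def back_structure_def back_clique_def by simp
  from finish[OF this] show ?thesis by simp
qed

section \<open>Small separators from the excluded minor\<close>

text \<open>This supplies \<open>sep\<close>. If \<open>card Q = s\<close>, then \<open>t\<close>
  disjoint connected sets adjacent to all the \<open>U b\<close> would complete a forbidden model,
  so the packing fails and a small hitting set exists. If \<open>card Q < s\<close>, a packing of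
  one set is already the desired \<open>T\<close>.\<close>

lemma small_separation:
  fixes U :: "nat \<Rightarrow> 'a set"
  assumes symE: "sym E" and fin: "finite V" and "s \<ge> 2" "t \<ge> 2"
    and no_model: "\<And>Q (U :: nat \<Rightarrow> 'a set) (F :: nat \<Rightarrow> 'a set). \<lbrakk>card Q = s; clique_model E Q U;
       \<forall>b\<in>Q. U b \<subseteq> V; \<forall>i<t. F i \<subseteq> V \<and> conn E (F i) \<and> (\<forall>b\<in>Q. F i \<inter> U b = {} \<and> touch E (F i) (U b));
       \<forall>i<t. \<forall>j<t. i \<noteq> j \<longrightarrow> F i \<inter> F j = {}\<rbrakk> \<Longrightarrow> False"
    and M: "V \<noteq> {} \<Longrightarrow> M \<ge> 1" "\<And>x. x * (q + 1) \<le> (s - 1) * card V \<Longrightarrow> (t - 1) * q + x \<le> M"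
    and C: "C \<subseteq> V" "conn E C" and Q: "finite Q" "card Q \<le> s" "clique_model E Q U"
      "\<forall>i\<in>Q. U i \<subseteq> V - C" "\<forall>i\<in>Q. touch E C (U i)"
  shows "(\<exists>T \<subseteq> C. conn E T \<and> card T \<le> M \<and> card Q < s \<and> (\<forall>i\<in>Q. touch E T (U i))) \<or>
      (\<exists>Y \<subseteq> C. card Y \<le> M \<and> (\<forall>S \<subseteq> C - Y. conn E S \<longrightarrow> (\<exists>i\<in>Q. \<not> touch E S (U i))))"
proof -
  \<comment> \<open>Neighbourhoods of the \<open>U b\<close> turn adjacency into intersection, as
    the packing lemma expects.\<close>
  define A where "A b = {v. \<exists>u\<in>U b. (v, u) \<in> E}" for b
  have A: "S \<inter> A b = {} \<longleftrightarrow> \<not> touch E S (U b)" for S b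
    by (auto simp: A_def touch_def)
  have finC: "finite C" using C(1) fin by (rule finite_subset)
  have CV: "(card Q - 1) * card C \<le> (s - 1) * card V"
    using Q(2) C(1) fin by (intro mult_mono card_mono) auto
  \<comment> \<open>The case \<open>x = 0\<close> of the bound on \<open>M\<close> shows that a set
    of \<open>q\<close> vertices is small enough for a part.\<close>
  have "1 * q \<le> (t - 1) * q" using \<open>t \<ge> 2\<close> by (intro mult_right_mono) auto
  moreover have "(t - 1) * q \<le> M" using M(2)[of 0] by simp
  ultimately have qM: "q \<le> M" by linarith
  show ?thesis
  proof (cases "card Q \<le> 1")
    case True
    \<comment> \<open>The packing lemma needs two sets to connect; with at most one, a single vertex
      of \<open>C\<close> suffices.\<close>
    obtain v where v: "v \<in> C" "\<forall>i\<in>Q. touch E {v} (U i)"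
    proof (cases "Q = {}")
      case True
      then show ?thesis using that conn_nonempty[OF C(2)] by blast
    next
      case False
      then have "card Q = 1" using True Q(1) by (simp add: le_Suc_eq)
      then obtain b where b: "Q = {b}" by (auto simp: card_1_singleton_iff)
      then obtain v u where "v \<in> C" "u \<in> U b" "(v, u) \<in> E" using Q(5) by (auto simp: touch_def)
      then show ?thesis using that[of v] b by (auto simp: touch_def)
    qed
    have "card {v} \<le> M" using M(1) v(1) C(1) by auto
    moreover have "card Q < s" using True \<open>s \<ge> 2\<close> by simp
    ultimately show ?thesis using v conn_singleton[of E v]
      by (intro disjI1 exI[of _ "{v}"]) auto
  next
    case False
    then have Q2: "card Q \<ge> 2" by simp
    define r where "r = (if card Q = s then t else 1)"
    have "(r - 1) * q \<le> (t - 1) * q" unfolding r_def by (intro mult_right_mono) auto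
    then have small: "(r - 1) * q + x \<le> M" if "x * (q + 1) \<le> (card Q - 1) * card C" for x
      using M(2)[of x] that CV by linarith
    from packing_or_hitting_set[OF symE finC Q2, of r q A] show ?thesis
    proof (elim disjE exE conjE)
      fix F :: "nat \<Rightarrow> 'a set"
      assume F: "\<forall>i<r. F i \<subseteq> C \<and> conn E (F i) \<and> card (F i) \<le> q \<and> (\<forall>b\<in>Q. F i \<inter> A b \<noteq> {})"
        and disj: "\<forall>i<r. \<forall>j<r. i \<noteq> j \<longrightarrow> F i \<inter> F j = {}"
      have touching: "touch E (F i) (U b)" if "i < r" "b \<in> Q" for i b
        using F that A by metis
      show ?thesis
      proof (cases "card Q = s")
        case True
        then have r: "r = t" by (simp add: r_def)
        have FC: "F i \<subseteq> C" "conn E (F i)" if "i < t" for i using F that r by auto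
        have FU: "F i \<inter> U b = {}" if "i < t" "b \<in> Q" for i b
          using FC(1)[OF that(1)] Q(4) that(2) by blast
        have "\<forall>i<t. F i \<subseteq> V \<and> conn E (F i) \<and> (\<forall>b\<in>Q. F i \<inter> U b = {} \<and> touch E (F i) (U b))"
          using FC FU touching C(1) unfolding r by (meson order_trans)
        moreover have "\<forall>b\<in>Q. U b \<subseteq> V" using Q(4) by blast
        ultimately have False using no_model[OF True Q(3)] disj r by metis
        then show ?thesis ..
      next
        case False
        then have "0 < r" by (simp add: r_def)
        then have "F 0 \<subseteq> C" "conn E (F 0)" "card (F 0) \<le> M" "\<forall>b\<in>Q. touch E (F 0) (U b)"
          using F touching[of 0] qM by auto
        moreover have "card Q < s" using False Q(2) by simp
        ultimately show ?thesis by metis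
      qed
    next
      fix Y x assume Y: "Y \<subseteq> C" "card Y \<le> (r - 1) * q + x"
        "x * (q + 1) \<le> (card Q - 1) * card C"
        "\<forall>S \<subseteq> C - Y. conn E S \<longrightarrow> (\<exists>b\<in>Q. S \<inter> A b = {})"
      have "card Y \<le> M" using Y(2) small[OF Y(3)] by linarith
      then show ?thesis using Y(1,4) unfolding A by metis
    qed
  qed
qed

lemma Kstar_is_minor:
  fixes U :: "'b \<Rightarrow> 'a set" and F :: "nat \<Rightarrow> 'a set"
  assumes "pair_graph G" and Q: "finite Q" "card Q = s" "clique_model (parcs G) Q U" "\<forall>b\<in>Q. U b \<subseteq> pverts G"
    and F: "\<forall>i<t. F i \<subseteq> pverts G \<and> conn (parcs G) (F i) \<and>
      (\<forall>b\<in>Q. F i \<inter> U b = {} \<and> touch (parcs G) (F i) (U b))"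
    and disj: "\<forall>i<t. \<forall>j<t. i \<noteq> j \<longrightarrow> F i \<inter> F j = {}"
  shows "is_minor (Kstar s t) G"
proof -
  interpret pair_graph G by fact
  have symE: "sym (parcs G)" using arcs_symmetric by (auto intro: symI)
  obtain e where e: "bij_betw e {0..<s} Q" using ex_bij_betw_nat_finite[OF Q(1)] Q(2) by auto
  have eQ: "e i \<in> Q" if "i < s" for i using e that by (auto simp: bij_betw_def)
  have einj: "e i \<noteq> e j" if "i < s" "j < s" "i \<noteq> j" for i j
    using e that by (auto simp: bij_betw_def inj_on_def)
  have U: "conn (parcs G) (U (e i))" "U (e i) \<subseteq> pverts G" if "i < s" for i
    using Q(3,4) eQ[OF that] by (auto simp: clique_model_def)
  have UU: "U (e i) \<inter> U (e j) = {}" "touch (parcs G) (U (e i)) (U (e j))" if "i < s" "j < s" "i \<noteq> j" for i j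
    using Q(3) eQ[of i] eQ[of j] einj[OF that] that by (auto simp: clique_model_def)
  have FU: "F j \<inter> U (e i) = {}" "touch (parcs G) (F j) (U (e i))" "touch (parcs G) (U (e i)) (F j)"
    if "i < s" "j < t" for i j
    using F eQ[of i] that touch_sym[OF symE, of "F j"] by auto
  \<comment> \<open>Numbers below \<open>s\<close> are the clique side, modelled by the
    \<open>U b\<close> through the enumeration \<open>e\<close>; the number \<open>s + i\<close> is
    modelled by \<open>F i\<close>.\<close>
  define branch where "branch x = (if x < s then U (e x) else F (x - s))" for x
  have arc: "\<exists>u\<in>branch x. \<exists>v\<in>branch y. (u, v) \<in> parcs G" if "(x, y) \<in> parcs (Kstar s t)" for x y
  proof -
    have "x < s \<and> y < s \<and> x \<noteq> y \<or> x < s \<and> s \<le> y \<and> y < s + t \<or> y < s \<and> s \<le> x \<and> x < s + t"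
      using that by (auto simp: Kstar_def Let_def)
    then consider "x < s" "y < s" "x \<noteq> y" | "x < s" "s \<le> y" "y - s < t" | "y < s" "s \<le> x" "x - s < t"
      by linarith
    then have "touch (parcs G) (branch x) (branch y)"
      by cases (use UU FU in \<open>auto simp: branch_def\<close>)
    then show ?thesis unfolding touch_def .
  qed
  have disj': "branch x \<inter> branch y = {}" if xy: "x < s + t" "y < s + t" "x \<noteq> y" for x y
  proof -
    consider "x < s" "y < s" | "x < s" "s \<le> y" "y - s < t" | "y < s" "s \<le> x" "x - s < t"
      | "s \<le> x" "s \<le> y" "x - s < t" "y - s < t" "x - s \<noteq> y - s"
      using xy by linarith
    then show ?thesis
    proof cases
      case 1
      then show ?thesis using UU(1) xy(3) by (simp add: branch_def)
    next
      case 2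
      then show ?thesis using FU(1)[of x "y - s"] by (simp add: branch_def Int_commute)
    next
      case 3
      then show ?thesis using FU(1)[of y "x - s"] by (simp add: branch_def)
    next
      case 4
      then show ?thesis using disj by (simp add: branch_def)
    qed
  qed
  have vert: "branch x \<subseteq> pverts G \<and> conn (parcs G) (branch x)" if "x < s + t" for x
  proof (cases "x < s")
    case True
    then show ?thesis using U by (simp add: branch_def)
  next
    case False
    then have "x - s < t" using that by simp
    then show ?thesis using F False by (simp add: branch_def)
  qed
  have pv: "pverts (Kstar s t) = {..<s + t}" by (auto simp: Kstar_def Let_def)
  show ?thesis
    unfolding is_minor_def connected_in_iff_conn[OF assms(1)]
  proof (intro exI[of _ branch] conjI ballI impI)
    fix x assume "x \<in> pverts (Kstar s t)"
    then show "branch x \<subseteq> pverts G" "conn (parcs G) (branch x)" using vert[of x] pv by auto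
  next
    fix x y assume "x \<in> pverts (Kstar s t)" "y \<in> pverts (Kstar s t)" "x \<noteq> y"
    then show "branch x \<inter> branch y = {}" using disj'[of x y] pv by auto
  next
    fix a assume "a \<in> parcs (Kstar s t)"
    then show "case a of (x, y) \<Rightarrow> \<exists>u\<in>branch x. \<exists>v\<in>branch y. (u, v) \<in> parcs G"
      using arc[of "fst a" "snd a"] by (simp add: case_prod_unfold)
  qed
qed

section \<open>The arithmetic of the part size\<close>

text \<open>With \<open>a = s - 1\<close>, \<open>c = t - 1\<close> and
  \<open>d = sqrt (a * n / c)\<close>, the bound \<open>m\<close> equals \<open>2 * c * d\<close>.
  Both summands are at most \<open>c * d\<close>: the first because \<open>q \<le> d\<close>, the
  second because \<open>x * (q + 1) \<le> a * n = c * d * d\<close> and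
  \<open>d < q + 1\<close>.\<close>

lemma width_bound:
  fixes s t n x :: nat and m :: real
  assumes "s \<ge> 2" "t \<ge> 2" and m: "m = 2 * sqrt ((real s - 1) * (real t - 1) * real n)"
    and q: "q = nat \<lfloor>sqrt ((real s - 1) * real n / (real t - 1))\<rfloor>"
    and x: "x * (q + 1) \<le> (s - 1) * n"
  shows "(t - 1) * q + x \<le> nat \<lfloor>m\<rfloor>"
proof -
  define a c d where "a = real s - 1" and "c = real t - 1" and "d = sqrt (a * real n / c)"
  have ac: "a \<ge> 1" "c \<ge> 1" using assms by (auto simp: a_def c_def)
  have d0: "d \<ge> 0" unfolding d_def using ac by simp
  have dd: "c * d\<^sup>2 = a * real n" unfolding d_def using ac by simp
  have "(c * d)\<^sup>2 = a * c * real n"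
    using dd by (simp add: power2_eq_square algebra_simps)
  then have "sqrt (a * c * real n) = c * d"
    using d0 ac by (metis real_sqrt_unique mult_nonneg_nonneg order_trans zero_le_one)
  then have md: "m = 2 * (c * d)" using m by (simp add: a_def c_def)
  have qd: "q = nat \<lfloor>d\<rfloor>" using q by (simp add: a_def c_def d_def)
  then have q1: "real q \<le> d" and q2: "d < real q + 1" using d0 by linarith+
  have "real x * (real q + 1) = real (x * (q + 1))" by (simp add: algebra_simps)
  also have "\<dots> \<le> real ((s - 1) * n)" using x by (rule of_nat_mono)
  also have "\<dots> = c * d * d" using assms(1) dd by (simp add: a_def of_nat_diff power2_eq_square)
  finally have xq: "real x * (real q + 1) \<le> c * d * d" .
  have "real x \<le> c * d"
  proof (cases "d = 0")
    \<comment> \<open>This happens only for \<open>n = 0\<close>, where division by \<open>d\<close>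
      is impossible; then \<open>x = 0\<close>.\<close>
    case True
    then have "real x * (real q + 1) \<le> 0" using xq by simp
    then show ?thesis using True by (simp add: mult_le_0_iff)
  next
    case False
    have "real x * d \<le> real x * (real q + 1)" using q2 by (intro mult_left_mono) auto
    then have "real x * d \<le> c * d * d" using xq by linarith
    moreover have "d > 0" using False d0 by simp
    ultimately show ?thesis by (rule mult_right_le_imp_le)
  qed
  moreover have "real ((t - 1) * q) \<le> c * d"
  proof -
    have "real ((t - 1) * q) = c * real q" using assms(2) by (simp add: c_def of_nat_diff)
    also have "\<dots> \<le> c * d" using q1 ac by (intro mult_left_mono) auto
    finally show ?thesis .
  qed
  ultimately have "real ((t - 1) * q + x) \<le> m" using md by simp
  then show ?thesis by (simp add: le_nat_floor)
qed

section \<open>Treewidth and the strong product\<close>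

text \<open>The function \<open>f\<close> gives the parents; the tests for positivity make
  \<open>0\<close> the root.\<close>

definition parent_tree :: "(nat \<Rightarrow> nat) \<Rightarrow> nat \<Rightarrow> nat pair_pre_digraph" where
  "parent_tree f N = \<lparr> pverts = {..<N},
     parcs = {(i, j). i < N \<and> j < N \<and> (0 < i \<and> j = f i \<or> 0 < j \<and> i = f j)} \<rparr>"

text \<open>This becomes \<open>H\<close>, with one vertex for each part.\<close>

definition back_graph :: "(nat \<Rightarrow> nat set) \<Rightarrow> nat \<Rightarrow> nat pair_pre_digraph" where
  "back_graph B N = \<lparr> pverts = {..<N},
     parcs = {(i, j). i < N \<and> j < N \<and> (i \<in> B j \<or> j \<in> B i)} \<rparr>"

lemma pair_graphI:
  assumes "finite (pverts G)" "parcs G \<subseteq> pverts G \<times> pverts G" "sym (parcs G)"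
    "\<And>x. (x, x) \<notin> parcs G"
  shows "pair_graph G"
proof -
  have "finite (parcs G)" using assms(1,2) by (meson finite_SigmaI finite_subset)
  then show ?thesis using assms by unfold_locales (auto simp: symmetric_def)
qed

lemma pair_graph_parent_tree:
  assumes "\<And>i. 0 < i \<Longrightarrow> f i < i"
  shows "pair_graph (parent_tree f N)"
proof (rule pair_graphI)
  show "(x, x) \<notin> parcs (parent_tree f N)" for x
    using assms[of x] by (auto simp: parent_tree_def)
qed (auto simp: parent_tree_def intro: symI)

lemma pair_graph_back_graph:
  assumes "back_structure s N B"
  shows "pair_graph (back_graph B N)"
proof (rule pair_graphI)
  show "(x, x) \<notin> parcs (back_graph B N)" for x
    using assms by (auto simp: back_graph_def back_structure_def)
qed (auto simp: back_graph_def intro: symI)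

section \<open>Walks, and the absence of cycles in parent trees\<close>

lemma pcas_nth:
  assumes "pcas u p v" "Suc i < length p"
  shows "snd (p ! i) = fst (p ! Suc i)"
  using assms
proof (induction p arbitrary: u i)
  case (Cons e p)
  then show ?case by (cases i; cases p) auto
qed simp

lemma pcas_last: "pcas u p v \<Longrightarrow> p \<noteq> [] \<Longrightarrow> snd (last p) = v"
  by (induction p arbitrary: u) auto

lemma pcas_hd: "pcas u p v \<Longrightarrow> p \<noteq> [] \<Longrightarrow> fst (hd p) = u"
  by (cases p) auto

lemma tl_pawalk_verts: "pcas u p v \<Longrightarrow> tl (pawalk_verts u p) = map snd p"
proof (induction p arbitrary: u)
  case (Cons e p)
  then show ?case by (cases p) auto
qed simp

lemma parent_tree_no_cycle:
  assumes f: "\<And>i. 0 < i \<Longrightarrow> f i < i"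
    and cyc: "pre_digraph.cycle (with_proj (parent_tree f N)) p"
  shows "length p < 3"
proof (rule ccontr)
  assume "\<not> length p < 3"
  define L where "L = length p"
  have L: "3 \<le> L" using \<open>\<not> length p < 3\<close> by (simp add: L_def)
  obtain u where arcs: "set p \<subseteq> parcs (parent_tree f N)" and cas: "pcas u p u"
    and dist: "distinct (tl (pawalk_verts u p))" and "p \<noteq> []"
    using cyc by (auto simp: pre_digraph.cycle_def pre_digraph.awalk_def cas_with_proj_eq
        awalk_verts_with_proj_eq)
  have dist': "distinct (map snd p)" using dist tl_pawalk_verts[OF cas] by simp
  \<comment> \<open>Indices are cyclic: the head of the last arc is the tail of the first.\<close>
  have next_arc: "snd (p ! i) = fst (p ! (Suc i mod L))" if "i < L" for i
  proof (cases "Suc i = L")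
    case True
    then have "i = length p - 1" by (simp add: L_def)
    then have "p ! i = last p" using \<open>p \<noteq> []\<close> by (simp add: last_conv_nth)
    then show ?thesis using True pcas_last[OF cas \<open>p \<noteq> []\<close>] pcas_hd[OF cas \<open>p \<noteq> []\<close>] \<open>p \<noteq> []\<close>
      by (simp add: hd_conv_nth)
  next
    case False
    then show ?thesis using pcas_nth[OF cas, of i] that by (simp add: L_def)
  qed
  \<comment> \<open>Both neighbours of the largest vertex of the cycle are its parent.\<close>
  define x where "x = Max (snd ` set p)"
  have "x \<in> snd ` set p" unfolding x_def using \<open>p \<noteq> []\<close> by (intro Max_in) auto
  then obtain i where i: "i < L" "snd (p ! i) = x" by (auto simp: in_set_conv_nth L_def)
  have le: "snd (p ! k) \<le> x" if "k < L" for k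
    unfolding x_def using that by (intro Max_ge) (auto simp: L_def)
  have arc: "p ! k \<in> parcs (parent_tree f N)" if "k < L" for k
    using arcs that by (auto simp: L_def)
  have nb: "y = f x" if "(x, y) \<in> parcs (parent_tree f N) \<or> (y, x) \<in> parcs (parent_tree f N)" "y \<le> x" for y
    using that f[of y] by (auto simp: parent_tree_def)
  \<comment> \<open>Arc \<open>i\<close> enters \<open>x\<close>, arc \<open>j\<close> leaves it,
    and arc \<open>h\<close> precedes arc \<open>i\<close>. So the heads of \<open>j\<close> and
    \<open>h\<close> are the two neighbours of \<open>x\<close> on the cycle.\<close>
  define j where "j = Suc i mod L"
  define h where "h = (if i = 0 then L - 1 else i - 1)"
  have jh: "j < L" "h < L" "Suc h mod L = i" using L i by (auto simp: j_def h_def)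
  have "p ! j = (x, snd (p ! j))" using next_arc[OF i(1)] i(2) by (metis j_def prod.collapse)
  then have sj: "snd (p ! j) = f x" using nb arc[OF jh(1)] le[OF jh(1)] by metis
  have "p ! i = (snd (p ! h), x)" using next_arc[OF jh(2)] jh(3) i(2) by (metis prod.collapse)
  then have sh: "snd (p ! h) = f x" using nb arc[OF i(1)] le[OF jh(2)] by metis
  have "map snd p ! j = map snd p ! h" using sj sh jh by (simp add: L_def)
  \<comment> \<open>Heads of arcs on a cycle are distinct, so \<open>i + 1\<close> and
    \<open>i - 1\<close> agree modulo \<open>L\<close>, which is impossible for
    \<open>L \<ge> 3\<close>.\<close>
  then have "j = h" using dist' jh(1,2) by (metis L_def length_map nth_eq_iff_index_eq)
  then show False using L i unfolding j_def h_def
    by (cases "Suc i = L") (auto split: if_splits)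
qed

lemma undirected_tree_parent_tree:
  assumes "\<And>i. 0 < i \<Longrightarrow> f i < i" "N \<ge> 1"
  shows "undirected_tree (parent_tree f N)"
proof -
  have pg: "pair_graph (parent_tree f N)" by (rule pair_graph_parent_tree) (rule assms)
  have "conn (parcs (parent_tree f N)) {..<N}"
  proof (rule conn_parent_function[of 0 _ f])
    fix x assume "x \<in> {..<N}" "x \<noteq> 0"
    then show "f x \<in> {..<N} \<and> f x < x \<and> (x, f x) \<in> parcs (parent_tree f N) \<and>
        (f x, x) \<in> parcs (parent_tree f N)"
      using assms(1)[of x] by (auto simp: parent_tree_def)
  qed (use assms(2) in auto)
  then have "connected_graph (parent_tree f N)"
    unfolding connected_graph_iff_conn[OF pg] by (simp add: parent_tree_def)
  then show ?thesis
    unfolding undirected_tree_def using pg parent_tree_no_cycle[of f N] assms(1) by (meson not_le)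
qed

section \<open>A tree decomposition of the quotient\<close>

text \<open>The bag of \<open>i\<close> is \<open>i\<close> together with \<open>B i\<close>, and
  the parent of \<open>i\<close> is the largest member of \<open>B i\<close>. If \<open>v\<close> is
  in \<open>B x\<close>, then \<open>v\<close> is the parent of \<open>x\<close> or, since
  \<open>B x\<close> is a clique, lies in \<open>B\<close> of that parent. Hence the bags containing
  \<open>v\<close> form a subtree with root \<open>v\<close>.\<close>

lemma treewidth_back_graph_le:
  assumes "back_structure s N B" "N \<ge> 1"
  shows "treewidth (back_graph B N) \<le> s"
proof -
  have B: "B i \<subseteq> {..<i}" "card (B i) \<le> s" "back_clique B (B i)" if "i < N" for i
    using assms(1) that by (auto simp: back_structure_def)
  have finB: "finite (B i)" if "i < N" for i using finite_subset[OF B(1)[OF that]] by simp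
  \<comment> \<open>The default \<open>0\<close> hangs an \<open>i\<close> with empty
    \<open>B i\<close> below the root, and keeps \<open>f i < i\<close> for every positive
    \<open>i\<close>, including those from \<open>N\<close> on.\<close>
  define f where "f i = (if i < N \<and> B i \<noteq> {} then Max (B i) else 0)" for i
  define bag where "bag i = insert i (B i)" for i
  have f_in: "f i \<in> B i" if "i < N" "B i \<noteq> {}" for i
    using that finB by (simp add: f_def)
  have f_less: "f i < i" if "0 < i" for i
    using that f_in[of i] B(1)[of i] by (cases "i < N \<and> B i \<noteq> {}") (auto simp: f_def)
  let ?T = "parent_tree f N"
  have tree: "undirected_tree ?T" using f_less assms(2) by (rule undirected_tree_parent_tree)
  then have pg: "pair_graph ?T" by (simp add: undirected_tree_def)
  have "tree_decomposition (back_graph B N) ?T bag"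
    unfolding tree_decomposition_def connected_in_iff_conn[OF pg]
  proof (intro conjI ballI)
    fix x assume "x \<in> pverts ?T"
    then show "bag x \<subseteq> pverts (back_graph B N)"
      using B(1)[of x] by (auto simp: bag_def parent_tree_def back_graph_def)
  next
    fix a assume "a \<in> parcs (back_graph B N)"
    then show "case a of (v, w) \<Rightarrow> \<exists>x\<in>pverts ?T. v \<in> bag x \<and> w \<in> bag x"
      by (auto simp: back_graph_def parent_tree_def bag_def)
  next
    fix v assume "v \<in> pverts (back_graph B N)"
    then have v: "v < N" by (simp add: back_graph_def)
    show "conn (parcs ?T) {x \<in> pverts ?T. v \<in> bag x}"
    proof (rule conn_parent_function[of v _ f])
      fix x assume x: "x \<in> {x \<in> pverts ?T. v \<in> bag x}" "x \<noteq> v"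
      then have xN: "x < N" and vB: "v \<in> B x" by (auto simp: parent_tree_def bag_def)
      have "v < x" using B(1)[OF xN] vB by auto
      then have fx: "f x < x" using f_less[of x] by simp
      have "v \<le> f x" using vB xN finB[OF xN] by (auto simp: f_def)
      then have "v \<in> bag (f x)"
      proof (cases "v = f x")
        case False
        have "f x \<in> B x" using f_in[OF xN] vB by blast
        then show ?thesis using B(3)[OF xN] vB \<open>v \<le> f x\<close> False
          unfolding back_clique_def bag_def by auto
      qed (simp add: bag_def)
      then show "f x \<in> {x \<in> pverts ?T. v \<in> bag x} \<and> f x < x \<and> (x, f x) \<in> parcs ?T \<and> (f x, x) \<in> parcs ?T"
        using fx xN \<open>v < x\<close> by (auto simp: parent_tree_def)
    qed (use v in \<open>auto simp: parent_tree_def bag_def\<close>)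
  qed (rule tree)
  then have "treewidth (back_graph B N) \<le> decomposition_width ?T bag"
    unfolding treewidth_def by (intro Least_le) blast
  also have "Max ((\<lambda>x. card (bag x)) ` pverts ?T) \<le> Suc s"
  proof (rule Max.boundedI)
    fix c assume "c \<in> (\<lambda>x. card (bag x)) ` pverts ?T"
    then obtain x where x: "x < N" "c = card (bag x)" by (auto simp: parent_tree_def)
    then show "c \<le> Suc s" using B(2)[OF x(1)] finB[OF x(1)] by (simp add: bag_def card_insert_if)
  qed (use assms(2) in \<open>auto simp: parent_tree_def lessThan_empty_iff\<close>)
  then have "decomposition_width ?T bag \<le> s" by (simp add: decomposition_width_def)
  finally show ?thesis .
qed

section \<open>Embedding into the strong product\<close>

lemma isomorphic_to_subgraphI:
  assumes "pair_graph G" "pair_graph Q" "inj_on h (pverts G)" "h ` pverts G \<subseteq> pverts Q"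
    and arc: "\<And>v w. (v, w) \<in> parcs G \<Longrightarrow> (h v, h w) \<in> parcs Q"
  shows "isomorphic_to_subgraph G Q"
proof -
  interpret G: pair_graph G by fact
  interpret Q: pair_graph Q by fact
  \<comment> \<open>The copy of \<open>G\<close> has the pairs of images as its arcs, with
    \<open>fst\<close> and \<open>snd\<close> as tail and head, as in
    \<open>with_proj Q\<close>.\<close>
  define k where "k = \<lparr> iso_verts = h, iso_arcs = map_prod h h, iso_head = snd, iso_tail = fst \<rparr>"
  have "inj_on (map_prod h h) (parcs G)"
  proof (rule inj_onI)
    fix a b assume ab: "a \<in> parcs G" "b \<in> parcs G" "map_prod h h a = map_prod h h b"
    then have "h (fst a) = h (fst b)" "h (snd a) = h (snd b)" by (auto simp: map_prod_def case_prod_unfold)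
    then show "a = b" using ab(1,2) assms(3)[THEN inj_onD]
        G.arc_fst_in_verts G.arc_snd_in_verts by (metis prod_eqI)
  qed
  then have iso: "pre_digraph.digraph_isomorphism (with_proj G) k"
    using assms(3) G.wf_digraph_axioms
    by (auto simp: pre_digraph.digraph_isomorphism_def k_def)
  have "wf_digraph (app_iso k (with_proj G))"
    using G.wf_digraphI_app_iso[OF iso] .
  then have "subgraph (app_iso k (with_proj G)) (with_proj Q)"
    using assms(4) arc Q.wf_digraph_axioms
    by (intro subgraphI) (auto simp: k_def compatible_def)
  with iso show ?thesis unfolding isomorphic_to_subgraph_def digraph_iso_def by blast
qed

text \<open>A vertex goes to the pair of its part and its position in that part. Adjacent vertices
  in different parts have adjacent first coordinates, and their positions are equal or adjacent in
  the complete graph.\<close>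

lemma partition_imp_product_subgraph:
  assumes "pair_graph G" and PP: "partial_partition (pverts G) (parcs G) s M {} N \<phi> B"
  shows "isomorphic_to_subgraph G (back_graph B N \<boxtimes> complete_graph M)"
proof -
  interpret G: pair_graph G by fact
  have lt: "\<And>v. v \<in> pverts G \<Longrightarrow> \<phi> v < N"
    and sz: "\<And>i. i < N \<Longrightarrow> card {v \<in> pverts G. \<phi> v = i} \<le> M"
    and bs: "back_structure s N B"
    and edge: "\<And>v w. v \<in> pverts G \<Longrightarrow> w \<in> pverts G \<Longrightarrow> (v, w) \<in> parcs G \<Longrightarrow>
        \<phi> v = \<phi> w \<or> \<phi> v \<in> B (\<phi> w) \<or> \<phi> w \<in> B (\<phi> v)"
    using PP unfolding partial_partition_def by auto
  have "\<exists>g. inj_on g {v \<in> pverts G. \<phi> v = i} \<and> g ` {v \<in> pverts G. \<phi> v = i} \<subseteq> {0..<M}" if "i < N" for i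
    using card_le_inj[of "{v \<in> pverts G. \<phi> v = i}" "{0..<M}"] sz[OF that] G.pair_finite_verts
    by auto
  then obtain g where g: "\<And>i. i < N \<Longrightarrow> inj_on (g i) {v \<in> pverts G. \<phi> v = i}"
      "\<And>i. i < N \<Longrightarrow> g i ` {v \<in> pverts G. \<phi> v = i} \<subseteq> {0..<M}"
    by metis
  define h where "h v = (\<phi> v, g (\<phi> v) v)" for v
  have gM: "g (\<phi> v) v < M" if "v \<in> pverts G" for v
    using g(2)[OF lt[OF that]] that by auto
  have inj: "inj_on h (pverts G)"
  proof (rule inj_onI)
    fix v w assume vw: "v \<in> pverts G" "w \<in> pverts G" "h v = h w"
    then have "\<phi> w = \<phi> v" "g (\<phi> v) v = g (\<phi> v) w" by (auto simp: h_def)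
    then show "v = w" using inj_onD[OF g(1)[OF lt[OF vw(1)]]] vw by simp
  qed
  have pgK: "pair_graph (complete_graph M)"
    by (rule pair_graphI) (auto simp: complete_graph_def intro: symI)
  show ?thesis
  proof (rule isomorphic_to_subgraphI[OF assms(1) _ inj])
    show "pair_graph (back_graph B N \<boxtimes> complete_graph M)"
      using pair_graph_back_graph[OF bs] pgK by (rule pair_graph_strong_product)
    show "h ` pverts G \<subseteq> pverts (back_graph B N \<boxtimes> complete_graph M)"
      using lt gM by (auto simp: h_def strong_product_def back_graph_def complete_graph_def)
  next
    fix v w assume vw: "(v, w) \<in> parcs G"
    then have V: "v \<in> pverts G" "w \<in> pverts G" by (auto dest: G.in_arcsD1 G.in_arcsD2)
    \<comment> \<open>For two vertices of one part this makes the second coordinates distinct, hence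
      adjacent in the complete graph.\<close>
    have "h v \<noteq> h w" using inj V G.no_loops'[OF vw] by (auto dest: inj_onD)
    then show "(h v, h w) \<in> parcs (back_graph B N \<boxtimes> complete_graph M)"
      using edge[OF V vw] lt[OF V(1)] lt[OF V(2)] gM[OF V(1)] gM[OF V(2)]
      by (auto simp: h_def strong_product_def back_graph_def complete_graph_def)
  qed
qed

theorem theorem3:
  fixes s t n :: nat and m :: real and G :: "'a pair_pre_digraph"
  assumes "s \<ge> 2" and "t \<ge> 2"
    and "pair_graph G" and "card (pverts G) = n"
    and "minor_free (Kstar s t) G"
    and "m = 2 * sqrt ((real s - 1) * (real t - 1) * real n)"
  shows "\<exists>H :: nat pair_pre_digraph. pair_graph H \<and> treewidth H \<le> s
           \<and> isomorphic_to_subgraph G (H \<boxtimes> complete_graph (nat \<lfloor>m\<rfloor>))"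
proof -
  interpret pair_graph G by fact
  let ?V = "pverts G" and ?E = "parcs G" and ?M = "nat \<lfloor>m\<rfloor>"
  have symE: "sym ?E" using arcs_symmetric by (auto intro: symI)
  define q where "q = nat \<lfloor>sqrt ((real s - 1) * real n / (real t - 1))\<rfloor>"
  have bound: "(t - 1) * q + x \<le> ?M" if "x * (q + 1) \<le> (s - 1) * card ?V" for x
    using width_bound[OF assms(1,2,6) q_def] that assms(4) by simp
  \<comment> \<open>Every factor under the root is at least \<open>1\<close> when the graph has a
    vertex; for \<open>n = 0\<close> the bound \<open>?M\<close> is \<open>0\<close>.\<close>
  have M1: "?M \<ge> 1" if "?V \<noteq> {}"
  proof -
    have "n \<ge> 1" using that assms(4) pair_finite_verts by (metis card_gt_0_iff Suc_leI One_nat_def)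
    then have "1 * 1 * 1 \<le> (real s - 1) * (real t - 1) * real n"
      using assms(1,2) by (intro mult_mono) auto
    then have "1 \<le> sqrt ((real s - 1) * (real t - 1) * real n)" by simp
    then have "1 \<le> m" using assms(6) by linarith
    then show ?thesis by (simp add: le_nat_floor)
  qed
  have no_model: False
    if "card Q = s" "clique_model ?E Q U" "\<forall>b\<in>Q. U b \<subseteq> ?V"
      "\<forall>i<t. F i \<subseteq> ?V \<and> conn ?E (F i) \<and> (\<forall>b\<in>Q. F i \<inter> U b = {} \<and> touch ?E (F i) (U b))"
      "\<forall>i<t. \<forall>j<t. i \<noteq> j \<longrightarrow> F i \<inter> F j = {}"
    for Q and U F :: "nat \<Rightarrow> 'a set"
  proof -
    have "finite Q" using that(1) assms(1) by (intro card_ge_0_finite) simp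
    then have "is_minor (Kstar s t) G" using Kstar_is_minor[OF assms(3) _ that] by simp
    then show False using assms(5) by (simp add: minor_free_def)
  qed
  \<comment> \<open>The construction receives its \<open>sep\<close> from
    \<open>small_separation\<close>, into which minor-freeness enters through
    \<open>no_model\<close> and the value of \<open>m\<close> through \<open>M1\<close> and
    \<open>bound\<close>.\<close>
  have "\<exists>N \<phi> B. N \<ge> 1 \<and> partial_partition ?V ?E s ?M {} N \<phi> B"
    by (rule ex_full_partition[OF symE pair_finite_verts],
        rule small_separation[OF symE pair_finite_verts assms(1,2) no_model M1 bound])
  then obtain N \<phi> B where N: "N \<ge> 1" and PP: "partial_partition ?V ?E s ?M {} N \<phi> B" by metis
  then have bs: "back_structure s N B" by (simp add: partial_partition_def)
  show ?thesis
    using pair_graph_back_graph[OF bs] treewidth_back_graph_le[OF bs N]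
      partition_imp_product_subgraph[OF assms(3) PP] by metis
qed

end
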